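(* Let $\mathcal{C}=(C_1,\dots,C_m)$, $m\ge 2$, be a collection of $m$ pinhole cameras with distinct centers. The line multiview variety $\mathcal{L}_{\mathcal{C}}$ is an irreducible variety of dimension $4$.
   Context: All projective spaces are complex. A pinhole camera is a full-rank matrix $C\in\mathbb C^{3\times 4}$; its center is the point $c=\ker(C)\in\mathbb P^3$. Let $\mathbb G$ be the Grassmannian of lines in $\mathbb P^3$. A line in $\mathbb P^2$ is identified with its linear equation $\ell\in\mathbb P^2$: a point $x$ is on the line if and only if $x^T\ell=0$. For a line $L\subset\mathbb P^3$ through points $x,y$ and not through the center of $C$, $C\cdot L$ denotes the line in $\mathbb P^2$ through $Cx$ and $Cy$. The joint camera map is the rational map $\Upsilon_{\mathcal C}:\mathbb G\dashrightarrow(\mathbb P^2)^m$, $L\mapsto (C_1\cdot L,\dots,C_m\cdot L)$, defined at the lines that pass through no camera center $c_i=\ker(C_i)$; $\Upsilon_{\mathcal C}(\mathbb G)$ denotes its image. The line multiview variety is the Zariski closure $\mathcal L_{\mathcal C}:=\overline{\Upsilon_{\mathcal C}(\mathbb G)}\subseteq(\mathbb P^2)^m$. *)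

theory Defs
  imports "HOL-Analysis.Analysis" "HOL-Library.Poly_Mapping" "HOL-Library.Extended_Nat"
begin

section \<open>Complex projective space\<close>

text \<open>The type \<open>'n proj\<close> is the set of lines through the origin of the coordinate space indexed
  by \<open>'n\<close>, a projective space of dimension \<open>CARD('n) - 1\<close>. In particular, \<open>3 proj\<close> is the
  projective plane.\<close>

definition proj_rel :: "complex^'n \<Rightarrow> complex^'n \<Rightarrow> bool" where
  "proj_rel x y \<longleftrightarrow> x \<noteq> 0 \<and> y \<noteq> 0 \<and> (\<exists>k. y = k *s x)"

lemma part_equivp_proj_rel: "part_equivp (proj_rel :: complex^'n \<Rightarrow> complex^'n \<Rightarrow> bool)"
proof (rule part_equivpI)
  show "\<exists>x :: complex^'n. proj_rel x x"
    by (rule exI[of _ "vec 1"]) (auto simp: proj_rel_def vec_eq_iff intro: exI[of _ 1])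
  show "symp (proj_rel :: complex^'n \<Rightarrow> complex^'n \<Rightarrow> bool)"
  proof (rule sympI)
    fix x y :: "complex^'n"
    assume "proj_rel x y"
    then obtain k where k: "x \<noteq> 0" "y \<noteq> 0" "y = k *s x" by (auto simp: proj_rel_def)
    then have "k \<noteq> 0" by auto
    then have "x = (1 / k) *s y" using k by (simp add: vec_eq_iff)
    then show "proj_rel y x" using k unfolding proj_rel_def by blast
  qed
  show "transp (proj_rel :: complex^'n \<Rightarrow> complex^'n \<Rightarrow> bool)"
    by (rule transpI) (auto simp: proj_rel_def vector_smult_assoc)
qed

quotient_type 'n proj = "complex^('n::finite)" / partial: proj_rel
  by (rule part_equivp_proj_rel)


section \<open>The Zariski topology on a product of projective spaces\<close>

text \<open>Points of the product of copies, indexed by \<open>'m\<close>, of \<open>'n proj\<close> are functions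
  \<open>'m \<Rightarrow> 'n proj\<close>. The variable with index \<open>(i, j)\<close> is the \<open>j\<close>-th homogeneous coordinate
  on the \<open>i\<close>-th factor.\<close>

type_synonym 'v cpoly = "('v \<Rightarrow>\<^sub>0 nat) \<Rightarrow>\<^sub>0 complex"

definition eval_poly :: "'v::finite cpoly \<Rightarrow> ('v \<Rightarrow> complex) \<Rightarrow> complex" where
  "eval_poly p x = (\<Sum>e\<in>Poly_Mapping.keys p.
     Poly_Mapping.lookup p e * (\<Prod>v\<in>UNIV. x v ^ Poly_Mapping.lookup e v))"

definition multihomogeneous :: "('m::finite \<times> 'n::finite) cpoly \<Rightarrow> bool" where
  "multihomogeneous p \<longleftrightarrow>
     (\<exists>d. \<forall>e\<in>Poly_Mapping.keys p. \<forall>i. (\<Sum>j\<in>UNIV. Poly_Mapping.lookup e (i, j)) = d i)"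

text \<open>\<open>rep_proj\<close> chooses a (nonzero) representative; whether a multihomogeneous polynomial
  vanishes does not depend on that choice.\<close>

definition zero_locus :: "('m::finite \<times> 'n::finite) cpoly set \<Rightarrow> ('m \<Rightarrow> 'n proj) set" where
  "zero_locus S = {X. \<forall>p\<in>S. eval_poly p (\<lambda>(i, j). rep_proj (X i) $ j) = 0}"

definition algebraic_set :: "('m::finite \<Rightarrow> 'n::finite proj) set \<Rightarrow> bool" where
  "algebraic_set Z \<longleftrightarrow> (\<exists>S. (\<forall>p\<in>S. multihomogeneous p) \<and> Z = zero_locus S)"

definition zariski :: "('m::finite \<Rightarrow> 'n::finite proj) topology" where
  "zariski = topology (\<lambda>U. algebraic_set (- U))"

lemma eval_poly_0 [simp]: "eval_poly 0 x = 0"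
  by (simp add: eval_poly_def)

lemma eval_poly_add: "eval_poly (p + q) x = eval_poly p x + eval_poly q x"
  unfolding eval_poly_def
  by (rule setsum_keys_plus_distrib) (auto simp: algebra_simps)

lemma eval_poly_single:
  "eval_poly (Poly_Mapping.single e c) x = c * (\<Prod>v\<in>UNIV. x v ^ Poly_Mapping.lookup e v)"
  by (simp add: eval_poly_def)

lemma cpoly_induct [case_names zero add_single]:
  fixes p :: "'v cpoly"
  assumes "P 0" and "\<And>p e c. P p \<Longrightarrow> P (p + Poly_Mapping.single e c)"
  shows "P p"
proof (induction p rule: update_induct)
  case const
  then show ?case by (rule assms(1))
next
  case (update p e c)
  have "Poly_Mapping.update e c p = p + Poly_Mapping.single e c"
    using update by (intro poly_mapping_eqI) (auto simp: lookup_update lookup_add lookup_single in_keys_iff when_def)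
  then show ?case using assms(2) update by simp
qed

lemma eval_poly_mult: "eval_poly (p * q) x = eval_poly p x * eval_poly q x"
proof (induction p rule: cpoly_induct)
  case zero
  then show ?case by simp
next
  case (add_single p e c)
  have "eval_poly (Poly_Mapping.single e c * q) x = eval_poly (Poly_Mapping.single e c) x * eval_poly q x"
  proof (induction q rule: cpoly_induct)
    case zero
    then show ?case by simp
  next
    case (add_single q e' c')
    then show ?case
      by (simp add: distrib_left eval_poly_add mult_single eval_poly_single lookup_add
          power_add prod.distrib algebra_simps)
  qed
  with add_single show ?case by (simp add: distrib_right eval_poly_add)
qed

lemma multihomogeneous_mult:
  assumes "multihomogeneous p" "multihomogeneous q"
  shows "multihomogeneous (p * q)"
proof -
  obtain d d' where
    d: "\<And>e i. e \<in> Poly_Mapping.keys p \<Longrightarrow> (\<Sum>j\<in>UNIV. Poly_Mapping.lookup e (i, j)) = d i" and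
    d': "\<And>e i. e \<in> Poly_Mapping.keys q \<Longrightarrow> (\<Sum>j\<in>UNIV. Poly_Mapping.lookup e (i, j)) = d' i"
    using assms unfolding multihomogeneous_def by metis
  have "(\<Sum>j\<in>UNIV. Poly_Mapping.lookup e (i, j)) = d i + d' i"
    if "e \<in> Poly_Mapping.keys (p * q)" for e i
    using keys_mult[of p q] that d d' by (force simp: lookup_add sum.distrib)
  then show ?thesis unfolding multihomogeneous_def by (intro exI[of _ "\<lambda>i. d i + d' i"]) blast
qed

lemma algebraic_set_Un:
  assumes "algebraic_set A" "algebraic_set B"
  shows "algebraic_set (A \<union> B)"
proof -
  obtain S T where S: "\<forall>p\<in>S. multihomogeneous p" "A = zero_locus S"
    and T: "\<forall>p\<in>T. multihomogeneous p" "B = zero_locus T"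
    using assms unfolding algebraic_set_def by blast
  have "A \<union> B = zero_locus {p * q |p q. p \<in> S \<and> q \<in> T}"
    unfolding S T zero_locus_def by (fastforce simp: eval_poly_mult)
  with S T show ?thesis
    unfolding algebraic_set_def
    by (intro exI[of _ "{p * q |p q. p \<in> S \<and> q \<in> T}"]) (auto intro: multihomogeneous_mult)
qed

lemma algebraic_set_Inter:
  assumes "\<And>Z. Z \<in> \<Z> \<Longrightarrow> algebraic_set Z"
  shows "algebraic_set (\<Inter>\<Z>)"
proof -
  obtain S where S: "\<And>Z. Z \<in> \<Z> \<Longrightarrow> (\<forall>p\<in>S Z. multihomogeneous p) \<and> Z = zero_locus (S Z)"
    using assms unfolding algebraic_set_def by metis
  have "\<Inter>\<Z> = zero_locus (\<Union>Z\<in>\<Z>. S Z)"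
  proof -
    have "zero_locus (\<Union>Z\<in>\<Z>. S Z) = (\<Inter>Z\<in>\<Z>. zero_locus (S Z))"
      by (auto simp: zero_locus_def)
    also have "\<dots> = \<Inter>\<Z>" using S by auto
    finally show ?thesis by simp
  qed
  with S show ?thesis
    unfolding algebraic_set_def by (intro exI[of _ "\<Union>Z\<in>\<Z>. S Z"]) auto
qed

lemma istopology_zariski:
  "istopology (\<lambda>U :: ('m::finite \<Rightarrow> 'n::finite proj) set. algebraic_set (- U))"
  unfolding istopology_def
proof (intro conjI allI impI)
  fix U V :: "('m \<Rightarrow> 'n proj) set"
  assume "algebraic_set (- U)" "algebraic_set (- V)"
  then show "algebraic_set (- (U \<inter> V))" by (simp add: algebraic_set_Un Compl_Int)
next
  fix \<U> :: "('m \<Rightarrow> 'n proj) set set"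
  assume "\<forall>U\<in>\<U>. algebraic_set (- U)"
  then have "algebraic_set (\<Inter>(uminus ` \<U>))" by (intro algebraic_set_Inter) auto
  then show "algebraic_set (- \<Union>\<U>)" by (metis uminus_Sup)
qed

lemma openin_zariski: "openin zariski U \<longleftrightarrow> algebraic_set (- U)"
  by (simp add: zariski_def istopology_zariski)

lemma topspace_zariski [simp]: "topspace zariski = UNIV"
proof -
  have "algebraic_set (- UNIV :: ('m::finite \<Rightarrow> 'n::finite proj) set)"
    unfolding algebraic_set_def
    by (intro exI[of _ "{1}"]) (auto simp: multihomogeneous_def zero_locus_def eval_poly_def)
  then show ?thesis by (metis openin_zariski openin_subset top.extremum_uniqueI)
qed

lemma closedin_zariski: "closedin zariski Z \<longleftrightarrow> algebraic_set Z"
  by (simp add: closedin_def openin_zariski Compl_eq_Diff_UNIV[symmetric])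


section \<open>Irreducibility and dimension\<close>

definition irreducible_space :: "'a topology \<Rightarrow> bool" where
  "irreducible_space T \<longleftrightarrow> topspace T \<noteq> {} \<and>
     \<not> (\<exists>A B. closedin T A \<and> closedin T B \<and> A \<noteq> topspace T \<and> B \<noteq> topspace T \<and>
              A \<union> B = topspace T)"

text \<open>Krull dimension: the supremum of the lengths \<open>n\<close> of chains
  \<open>Z 0 \<subset> Z 1 \<subset> \<dots> \<subset> Z n\<close> of irreducible closed subsets.\<close>

definition krull_dim :: "'a topology \<Rightarrow> enat" where
  "krull_dim T = Sup {enat n |n. \<exists>Z :: nat \<Rightarrow> 'a set.
     (\<forall>i\<le>n. closedin T (Z i) \<and> irreducible_space (subtopology T (Z i))) \<and>
     (\<forall>i<n. Z i \<subset> Z (Suc i))}"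

definition irreducible_variety :: "('m::finite \<Rightarrow> 'n::finite proj) set \<Rightarrow> bool" where
  "irreducible_variety V \<longleftrightarrow> closedin zariski V \<and> irreducible_space (subtopology zariski V)"

definition variety_dim :: "('m::finite \<Rightarrow> 'n::finite proj) set \<Rightarrow> enat" where
  "variety_dim V = krull_dim (subtopology zariski V)"


section \<open>Cameras and the line multiview variety\<close>

text \<open>Linear subspaces of projective 3-space are given by the corresponding linear subspaces of
  \<open>complex^4\<close>: points are one-dimensional and lines are two-dimensional subspaces, and incidence
  is inclusion.\<close>

definition pinhole_camera :: "complex^4^3 \<Rightarrow> bool" where
  "pinhole_camera C \<longleftrightarrow> rank C = 3"

definition center :: "complex^4^3 \<Rightarrow> (complex^4) set" where
  "center C = {v. C *v v = 0}"

definition lines_P3 :: "(complex^4) set set" where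
  "lines_P3 = {L. vec.subspace L \<and> vec.dim L = 2}"

lift_definition on_line :: "3 proj \<Rightarrow> 3 proj \<Rightarrow> bool"
  is "\<lambda>x l :: complex^3. (\<Sum>j\<in>UNIV. x $ j * l $ j) = 0"
proof -
  fix x x' l l' :: "complex^3"
  assume "proj_rel x x'" "proj_rel l l'"
  then obtain a b where ab: "x' = a *s x" "l' = b *s l" "x' \<noteq> 0" "l' \<noteq> 0"
    by (auto simp: proj_rel_def)
  have "(\<Sum>j\<in>UNIV. x' $ j * l' $ j) = a * b * (\<Sum>j\<in>UNIV. x $ j * l $ j)"
    by (simp add: ab sum_distrib_left algebra_simps)
  moreover have "a \<noteq> 0" "b \<noteq> 0" using ab by auto
  ultimately show "((\<Sum>j\<in>UNIV. x $ j * l $ j) = 0) = ((\<Sum>j\<in>UNIV. x' $ j * l' $ j) = 0)"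
    by simp
qed

text \<open>The line \<open>C \<cdot> L\<close> through \<open>C x\<close> and \<open>C y\<close>, where \<open>L\<close> is the line through \<open>x\<close> and \<open>y\<close>,
  as a point of the dual plane. This is meaningful only if \<open>L\<close> avoids the center of \<open>C\<close>.\<close>

definition camera_line :: "complex^4^3 \<Rightarrow> (complex^4) set \<Rightarrow> 3 proj" where
  "camera_line C L = (THE l. \<exists>x y. L = vec.span {x, y} \<and>
     on_line (abs_proj (C *v x)) l \<and> on_line (abs_proj (C *v y)) l)"

definition joint_camera_domain :: "('m::finite \<Rightarrow> complex^4^3) \<Rightarrow> (complex^4) set set" where
  "joint_camera_domain C = {L \<in> lines_P3. \<forall>i. \<not> center (C i) \<subseteq> L}"

definition joint_camera_map ::
    "('m::finite \<Rightarrow> complex^4^3) \<Rightarrow> (complex^4) set \<Rightarrow> 'm \<Rightarrow> 3 proj" where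
  "joint_camera_map C L = (\<lambda>i. camera_line (C i) L)"

definition line_multiview_variety :: "('m::finite \<Rightarrow> complex^4^3) \<Rightarrow> ('m \<Rightarrow> 3 proj) set" where
  "line_multiview_variety C = zariski closure_of (joint_camera_map C ` joint_camera_domain C)"

end

theory Submission
  imports Defs
begin

text \<open>The lines of projective 3-space that miss the line joining two chosen camera centers \<open>p\<close> and
  \<open>q\<close> form an affine chart of the Grassmannian with four coordinates: such a line is spanned by
  \<open>b0 + s 3 p + s 1 q\<close> and \<open>b1 + s 4 p + s 2 q\<close>, where \<open>b0, b1, p, q\<close> is a basis. The image of the line
  under a camera is represented by a cross product, which is polynomial in these coordinates, and
  the chart is dense. So the line multiview variety is the closure of the image of a polynomial
  map in four parameters.

  Irreducibility holds because two points of the parameter space are joined by a line, and finitely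
  many polynomials that are not identically zero on a line have a common nonzero there
  (\<open>irreducible_closure_of_parametrized\<close>).

  The dimension is at most 4 because a strict chain of \<open>n + 1\<close> irreducible closed sets gives \<open>n\<close>
  functions that satisfy no algebraic relation (\<open>no_algebraic_relation_along_chain\<close>), whereas by
  counting monomials five rational functions with a common denominator in four variables always
  satisfy one (\<open>algebraic_dependence\<close>).

  The dimension is at least 4 because the closures of the images of the coordinate subspaces of the
  chart form a strict chain (\<open>variety_dim_parametrized_ge\<close>). The camera with center \<open>p\<close>
  forgets \<open>s 3\<close> and \<open>s 4\<close>, and its image line recovers \<open>s 1\<close> and \<open>s 2\<close>, while the camera with center \<open>q\<close> recovers \<open>s 3\<close> and \<open>s 4\<close>. Each coordinate vanishes
  exactly if one of the two image lines passes through a certain fixed point, which is a linear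
  condition.\<close>


section \<open>Algebras of complex-valued functions\<close>

text \<open>Polynomial functions on a line, polynomial functions on an affine space and regular functions on
  a chart of a product of projective spaces all form such an algebra, and each of them has to be
  closed under substitution into a polynomial.\<close>

locale function_algebra =
  fixes R :: "('a \<Rightarrow> complex) set"
  assumes const: "(\<lambda>_. c) \<in> R"
    and add: "f \<in> R \<Longrightarrow> g \<in> R \<Longrightarrow> (\<lambda>x. f x + g x) \<in> R"
    and mult: "f \<in> R \<Longrightarrow> g \<in> R \<Longrightarrow> (\<lambda>x. f x * g x) \<in> R"
begin

lemma diff: "f \<in> R \<Longrightarrow> g \<in> R \<Longrightarrow> (\<lambda>x. f x - g x) \<in> R"
  using add[of f "\<lambda>x. - 1 * g x"] mult[OF const[of "- 1"]] by simp

lemma sum: "(\<And>i. i \<in> I \<Longrightarrow> f i \<in> R) \<Longrightarrow> (\<lambda>x. \<Sum>i\<in>I. f i x) \<in> R"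
  by (induction I rule: infinite_finite_induct) (auto intro: const add)

lemma prod: "(\<And>i. i \<in> I \<Longrightarrow> f i \<in> R) \<Longrightarrow> (\<lambda>x. \<Prod>i\<in>I. f i x) \<in> R"
  by (induction I rule: infinite_finite_induct) (auto intro: const mult)

lemma power: "f \<in> R \<Longrightarrow> (\<lambda>x. f x ^ n) \<in> R"
  by (induction n) (auto intro: const mult)

lemma eval_poly: "(\<And>v. g v \<in> R) \<Longrightarrow> (\<lambda>x. eval_poly p (\<lambda>v. g v x)) \<in> R"
  unfolding eval_poly_def by (intro sum mult const prod power)

end

interpretation univariate: function_algebra "range (poly :: complex poly \<Rightarrow> _)"
proof
  fix f g :: "complex \<Rightarrow> complex"
  assume "f \<in> range poly" "g \<in> range poly"
  then obtain p q where pq: "f = poly p" "g = poly q" by auto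
  show "(\<lambda>x. f x + g x) \<in> range poly" by (rule range_eqI[of _ _ "p + q"]) (auto simp: pq)
  show "(\<lambda>x. f x * g x) \<in> range poly" by (rule range_eqI[of _ _ "p * q"]) (auto simp: pq)
next
  show "(\<lambda>_. c) \<in> range poly" for c :: complex
    by (rule range_eqI[of _ _ "[:c:]"]) auto
qed

lemma univariate_id: "(\<lambda>t. t) \<in> range (poly :: complex poly \<Rightarrow> _)"
  by (rule range_eqI[of _ _ "[:0, 1:]"]) auto

text \<open>The substitute for the irreducibility of affine space: a nonzero polynomial has finitely many
  roots, so conditions that each hold somewhere on a line hold at a common point of it.\<close>

lemma common_nonzero:
  assumes "finite F" and "F \<subseteq> range (poly :: complex poly \<Rightarrow> _)" and "\<And>f. f \<in> F \<Longrightarrow> \<exists>t. f t \<noteq> 0"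
  shows "\<exists>t. \<forall>f\<in>F. f t \<noteq> 0"
proof -
  have "finite {t. f t = 0}" if f: "f \<in> F" for f
  proof -
    obtain p where "f = poly p" using f assms(2) by auto
    moreover from this have "p \<noteq> 0" using assms(3)[OF f] by auto
    ultimately show ?thesis by (simp add: poly_roots_finite)
  qed
  then have "finite (\<Union>f\<in>F. {t. f t = 0})" using assms(1) by auto
  then have "(\<Union>f\<in>F. {t. f t = 0}) \<noteq> UNIV"
    using infinite_UNIV_char_0[where 'a = complex] by metis
  then show ?thesis by auto
qed

definition poly_var :: "'v \<Rightarrow> 'v cpoly" where
  "poly_var v = Poly_Mapping.single (Poly_Mapping.single v 1) 1"

lemma eval_poly_const: "eval_poly (Poly_Mapping.single 0 c) x = c"
  by (simp add: eval_poly_single)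

lemma eval_poly_1 [simp]: "eval_poly 1 x = 1"
  by (metis eval_poly_const single_one)

lemma eval_poly_var [simp]: "eval_poly (poly_var v) x = x v"
proof -
  have "(\<Prod>u\<in>UNIV. x u ^ Poly_Mapping.lookup (Poly_Mapping.single v 1) u)
      = (\<Prod>u\<in>UNIV. if u = v then x v else 1)"
    by (intro prod.cong) (auto simp: lookup_single when_def)
  then show ?thesis by (simp add: poly_var_def eval_poly_single)
qed

lemma eval_poly_prod: "eval_poly (\<Prod>i\<in>I. p i) x = (\<Prod>i\<in>I. eval_poly (p i) x)"
  by (induction I rule: infinite_finite_induct) (auto simp: eval_poly_mult)

lemma eval_poly_power: "eval_poly (p ^ n) x = eval_poly p x ^ n"
  by (induction n) (auto simp: eval_poly_mult)

lemma eval_poly_sum: "eval_poly (\<Sum>i\<in>I. p i) x = (\<Sum>i\<in>I. eval_poly (p i) x)"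
  by (induction I rule: infinite_finite_induct) (auto simp: eval_poly_add)

interpretation multivariate: function_algebra "range (eval_poly :: 'v::finite cpoly \<Rightarrow> _)"
proof
  fix f g :: "('v \<Rightarrow> complex) \<Rightarrow> complex"
  assume "f \<in> range eval_poly" "g \<in> range eval_poly"
  then obtain p q where pq: "f = eval_poly p" "g = eval_poly q" by auto
  show "(\<lambda>x. f x + g x) \<in> range eval_poly"
    by (rule range_eqI[of _ _ "p + q"]) (auto simp: pq eval_poly_add)
  show "(\<lambda>x. f x * g x) \<in> range eval_poly"
    by (rule range_eqI[of _ _ "p * q"]) (auto simp: pq eval_poly_mult)
next
  show "(\<lambda>_. c) \<in> range (eval_poly :: 'v cpoly \<Rightarrow> _)" for c :: complex
    by (rule range_eqI[of _ _ "Poly_Mapping.single 0 c"]) (auto simp: eval_poly_const)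
qed

lemma multivariate_var: "(\<lambda>x. x v) \<in> range (eval_poly :: 'v::finite cpoly \<Rightarrow> _)"
  by (rule range_eqI[of _ _ "poly_var v"]) auto


section \<open>Algebraic dependence of many polynomials in few variables\<close>

lemma homogeneous_system_nontrivial_solution:
  fixes a :: "'i \<Rightarrow> 'j \<Rightarrow> complex"
  assumes "finite J" "finite I" "card J < card I"
  shows "\<exists>c. (\<exists>i\<in>I. c i \<noteq> 0) \<and> (\<forall>j\<in>J. (\<Sum>i\<in>I. c i * a i j) = 0)"
  using assms
proof (induction J arbitrary: I a rule: finite_induct)
  case empty
  then obtain i where "i \<in> I" by fastforce
  then show ?case by (intro exI[of _ "\<lambda>_. 1"]) auto
next
  case (insert j J)
  show ?case
  proof (cases "\<forall>i\<in>I. a i j = 0")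
    case True
    with insert.IH[of I a] insert.prems insert.hyps show ?thesis by auto
  next
    case False
    then obtain k where k: "k \<in> I" "a k j \<noteq> 0" by auto
    define b where "b = (\<lambda>i l. a i l - a i j / a k j * a k l)"
    have "card J < card (I - {k})" using insert k by auto
    then obtain c where c: "\<exists>i\<in>I - {k}. c i \<noteq> 0"
        "\<And>l. l \<in> J \<Longrightarrow> (\<Sum>i\<in>I - {k}. c i * b i l) = 0"
      using insert.IH[of "I - {k}" b] insert.prems by blast
    define c' where "c' = c(k := - (\<Sum>i\<in>I - {k}. c i * a i j) / a k j)"
    have "(\<Sum>i\<in>I. c' i * a i l) = (\<Sum>i\<in>I - {k}. c i * b i l)" for l
    proof -
      have "(\<Sum>i\<in>I. c' i * a i l) = c' k * a k l + (\<Sum>i\<in>I - {k}. c i * a i l)"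
        using k insert.prems by (subst sum.remove[of I k]) (auto simp: c'_def)
      also have "c' k * a k l = - (\<Sum>i\<in>I - {k}. c i * (a i j / a k j * a k l))"
        by (simp add: c'_def sum_distrib_right sum_divide_distrib mult.assoc)
      finally show ?thesis
        by (simp add: b_def right_diff_distrib sum_subtractf)
    qed
    moreover have "(\<Sum>i\<in>I - {k}. c i * b i j) = 0"
      using k by (simp add: b_def)
    moreover have "\<exists>i\<in>I. c' i \<noteq> 0" using c(1) by (auto simp: c'_def)
    ultimately show ?thesis using c(2) by (intro exI[of _ c']) auto
  qed
qed

text \<open>Bounding the degree in each variable separately makes the bounded monomials a box, which is
  counted by a power instead of a binomial coefficient.\<close>

definition box_degree :: "nat \<Rightarrow> 'v cpoly \<Rightarrow> bool" where
  "box_degree d p \<longleftrightarrow> (\<forall>e\<in>Poly_Mapping.keys p. \<forall>v. Poly_Mapping.lookup e v \<le> d)"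

lemma box_degree_mono: "box_degree d p \<Longrightarrow> d \<le> d' \<Longrightarrow> box_degree d' p"
  unfolding box_degree_def by (meson order.trans)

lemma box_degree_mult: "box_degree d p \<Longrightarrow> box_degree d' q \<Longrightarrow> box_degree (d + d') (p * q)"
  unfolding box_degree_def using keys_mult[of p q] by (force simp: lookup_add intro: add_mono)

lemma box_degree_1: "box_degree d 1"
  unfolding box_degree_def by simp

lemma box_degree_power: "box_degree d p \<Longrightarrow> box_degree (n * d) (p ^ n)"
  by (induction n) (auto simp: box_degree_1 box_degree_mult)

lemma box_degree_prod:
  "finite I \<Longrightarrow> (\<And>i. i \<in> I \<Longrightarrow> box_degree d (p i)) \<Longrightarrow> box_degree (card I * d) (\<Prod>i\<in>I. p i)"
  by (induction I rule: finite_induct) (auto simp: box_degree_1 box_degree_mult)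

lemma box_degree_exists:
  fixes p :: "'v::finite cpoly"
  shows "\<exists>d. box_degree d p"
proof -
  let ?D = "(\<lambda>(e, v). Poly_Mapping.lookup e v) ` (Poly_Mapping.keys p \<times> UNIV)"
  have "finite ?D" by auto
  have "Poly_Mapping.lookup e v \<le> Max ?D" if "e \<in> Poly_Mapping.keys p" for e v
    using \<open>finite ?D\<close> by (rule Max_ge) (rule image_eqI[of _ _ "(e, v)"], use that in auto)
  then show ?thesis unfolding box_degree_def by blast
qed

lemma box_exponents:
  fixes d :: nat
  defines "J \<equiv> {e :: 'v::finite \<Rightarrow>\<^sub>0 nat. \<forall>v. Poly_Mapping.lookup e v \<le> d}"
  shows "finite J" and "card J \<le> Suc d ^ CARD('v)"
proof -
  have inj: "inj_on Poly_Mapping.lookup J" by (rule inj_onI) (simp add: lookup_inject)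
  have sub: "Poly_Mapping.lookup ` J \<subseteq> PiE UNIV (\<lambda>_. {..d})" by (auto simp: J_def)
  have fin: "finite (PiE (UNIV :: 'v set) (\<lambda>_. {..d}))" by (intro finite_PiE) auto
  show "finite J" using inj_on_finite[OF inj sub fin] .
  have "card J \<le> card (PiE (UNIV :: 'v set) (\<lambda>_. {..d}))" using card_inj_on_le[OF inj sub fin] .
  also have "\<dots> = Suc d ^ CARD('v)" by (simp add: card_PiE)
  finally show "card J \<le> Suc d ^ CARD('v)" .
qed

text \<open>Counting: the monomials in \<open>g k / h\<close> for \<open>k < n\<close> with exponents at most \<open>D\<close> are
  \<open>(D + 1) ^ n\<close> many. Multiplied by \<open>h ^ (n * D)\<close> they become polynomials whose degree in each
  variable is linear in \<open>D\<close>, so they lie in a space of dimension \<open>O(D ^ CARD('v))\<close> and are linearly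
  dependent once \<open>D\<close> is large. The relation is stated with the denominators cleared.\<close>

lemma algebraic_dependence:
  fixes g :: "nat \<Rightarrow> 'v::finite cpoly" and h :: "'v cpoly"
  assumes "CARD('v) < n"
  shows "\<exists>D c. (\<exists>e \<in> PiE {..<n} (\<lambda>_. {..D}). c e \<noteq> 0) \<and>
    (\<forall>s. (\<Sum>e\<in>PiE {..<n} (\<lambda>_. {..D}). c e *
       (\<Prod>k<n. eval_poly (g k) s ^ e k * eval_poly h s ^ (D - e k))) = 0)"
proof -
  have "\<exists>d. box_degree d h \<and> (\<forall>k<n. box_degree d (g k))"
  proof -
    have "\<forall>k. \<exists>d. box_degree d (g k)" using box_degree_exists by blast
    then obtain dg where dg: "\<And>k. box_degree (dg k) (g k)" by metis
    obtain dh where dh: "box_degree dh h" using box_degree_exists by blast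
    have "box_degree (dh + (\<Sum>k<n. dg k)) (g k)" if "k < n" for k
      using dg[of k] by (rule box_degree_mono) (use that member_le_sum[of k "{..<n}" dg] in auto)
    moreover have "box_degree (dh + (\<Sum>k<n. dg k)) h" using dh by (rule box_degree_mono) auto
    ultimately show ?thesis by blast
  qed
  then obtain d0 where d0: "box_degree d0 h" "\<And>k. k < n \<Longrightarrow> box_degree d0 (g k)" by auto
  define d where "d = Suc d0"
  have d: "box_degree d h" "\<And>k. k < n \<Longrightarrow> box_degree d (g k)"
    using d0 box_degree_mono[of d0 _ d] by (auto simp: d_def)
  \<comment> \<open>The least value for which \<open>(n * d * (D + 1)) ^ CARD('v) < (D + 1) ^ (CARD('v) + 1)\<close>.\<close>
  define D where "D = (n * d) ^ CARD('v)"
  define E where "E = PiE {..<n} (\<lambda>_. {..D})"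
  define N where "N = n * (D * d)"
  define J where "J = {e :: 'v \<Rightarrow>\<^sub>0 nat. \<forall>v. Poly_Mapping.lookup e v \<le> N}"
  define P where "P = (\<lambda>e. \<Prod>k<n. g k ^ e k * h ^ (D - e k))"
  have finE: "finite E" unfolding E_def by (intro finite_PiE) auto
  have keysP: "Poly_Mapping.keys (P e) \<subseteq> J" if e: "e \<in> E" for e
  proof -
    have "box_degree (D * d) (g k ^ e k * h ^ (D - e k))" if k: "k < n" for k
    proof -
      have "e k \<le> D" using e k by (auto simp: E_def)
      then have "e k * d + (D - e k) * d = D * d" by (simp flip: add_mult_distrib)
      with box_degree_mult[OF box_degree_power[OF d(2)[OF k], of "e k"]
          box_degree_power[OF d(1), of "D - e k"]] show ?thesis by simp
    qed
    then have "box_degree N (P e)"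
      using box_degree_prod[of "{..<n}" "D * d" "\<lambda>k. g k ^ e k * h ^ (D - e k)"]
      by (simp add: P_def N_def)
    then show ?thesis by (auto simp: box_degree_def J_def)
  qed
  have "0 < n * d" using assms by (simp add: d_def)
  then have N_le: "Suc N \<le> n * d * Suc D" by (simp add: N_def algebra_simps)
  have "card J \<le> Suc N ^ CARD('v)" unfolding J_def by (rule box_exponents)
  also have "\<dots> \<le> (n * d * Suc D) ^ CARD('v)"
    using N_le by (rule power_mono) simp
  also have "\<dots> = D * Suc D ^ CARD('v)" by (simp only: D_def power_mult_distrib[of "n * d"])
  also have "\<dots> < Suc D ^ Suc CARD('v)" by simp
  also have "\<dots> \<le> Suc D ^ n" using assms by (intro power_increasing) auto
  also have "\<dots> = card E" by (simp add: E_def card_PiE)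
  finally have "card J < card E" .
  then obtain c where c: "\<exists>e\<in>E. c e \<noteq> 0"
    "\<And>j. j \<in> J \<Longrightarrow> (\<Sum>e\<in>E. c e * Poly_Mapping.lookup (P e) j) = 0"
    using homogeneous_system_nontrivial_solution[of J E "\<lambda>e. Poly_Mapping.lookup (P e)"]
      finE box_exponents(1)[of N, where 'v = 'v] unfolding J_def by blast
  have "(\<Sum>e\<in>E. c e * eval_poly (P e) s) = 0" for s
  proof -
    let ?m = "\<lambda>j. \<Prod>v\<in>UNIV. s v ^ Poly_Mapping.lookup j v"
    have "eval_poly (P e) s = (\<Sum>j\<in>J. Poly_Mapping.lookup (P e) j * ?m j)" if "e \<in> E" for e
      unfolding eval_poly_def using keysP[OF that] box_exponents(1)[of N, where 'v = 'v]
      by (intro sum.mono_neutral_left) (auto simp: J_def in_keys_iff)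
    then have "(\<Sum>e\<in>E. c e * eval_poly (P e) s)
        = (\<Sum>e\<in>E. \<Sum>j\<in>J. c e * Poly_Mapping.lookup (P e) j * ?m j)"
      by (intro sum.cong) (auto simp: sum_distrib_left mult.assoc)
    also have "\<dots> = (\<Sum>j\<in>J. (\<Sum>e\<in>E. c e * Poly_Mapping.lookup (P e) j) * ?m j)"
      by (subst sum.swap) (simp add: sum_distrib_right)
    also have "\<dots> = 0" using c(2) by simp
    finally show ?thesis .
  qed
  then show ?thesis using c(1) unfolding E_def
    by (intro exI[of _ D] exI[of _ c]) (auto simp: P_def eval_poly_prod eval_poly_mult eval_poly_power)
qed


section \<open>Chains of irreducible sets and algebraic relations\<close>

text \<open>Functions of which the \<open>k\<close>-th vanishes on the \<open>k\<close>-th member of a chain of irreducible sets, but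
  not on the next one, are algebraically independent on the last member. Dividing a relation by the
  highest possible power of the last function is allowed by irreducibility; restricted to the
  preceding set, what remains is a nontrivial relation between the other functions. At the bottom
  of the chain the relation is a nonzero constant.\<close>

lemma (in function_algebra) no_algebraic_relation_along_chain:
  fixes f :: "nat \<Rightarrow> 'a \<Rightarrow> complex" and c :: "(nat \<Rightarrow> nat) \<Rightarrow> complex"
  assumes "Z 0 \<noteq> {}"
    and chain: "\<And>k. k < n \<Longrightarrow> Z k \<subseteq> Z (Suc k)"
    and prime: "\<And>k f g. k \<le> n \<Longrightarrow> f \<in> R \<Longrightarrow> g \<in> R \<Longrightarrow> \<forall>x\<in>Z k. f x * g x = 0 \<Longrightarrow>
        (\<forall>x\<in>Z k. f x = 0) \<or> (\<forall>x\<in>Z k. g x = 0)"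
    and f: "\<And>k. k < n \<Longrightarrow> f k \<in> R"
    and van: "\<And>k x. k < n \<Longrightarrow> x \<in> Z k \<Longrightarrow> f k x = 0"
    and nonvan: "\<And>k. k < n \<Longrightarrow> \<exists>x\<in>Z (Suc k). f k x \<noteq> 0"
    and E: "finite E" "E \<noteq> {}" "\<And>e. e \<in> E \<Longrightarrow> c e \<noteq> 0"
      "\<And>e e'. e \<in> E \<Longrightarrow> e' \<in> E \<Longrightarrow> \<forall>k<n. e k = e' k \<Longrightarrow> e = e'"
    and rel: "\<And>x. x \<in> Z n \<Longrightarrow> (\<Sum>e\<in>E. c e * (\<Prod>k<n. f k x ^ e k)) = 0"
  shows False
  using assms
proof (induction n arbitrary: E)
  case 0
  then obtain e where e: "e \<in> E" by auto
  with 0 have "E = {e}" by auto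
  with 0 e show False by auto
next
  case (Suc n)
  note prems = Suc.prems
  define a where "a = Min ((\<lambda>e. e n) ` E)"
  have a: "a \<le> e n" if "e \<in> E" for e using that prems by (auto simp: a_def)
  have "a \<in> (\<lambda>e. e n) ` E" unfolding a_def using prems by (intro Min_in) auto
  \<comment> \<open>The quotient of the relation by \<open>f n ^ a\<close>; on \<open>Z n\<close> only its terms with exponent \<open>a\<close> survive.\<close>
  define S where "S = (\<lambda>x. \<Sum>e\<in>E. c e * (\<Prod>k<n. f k x ^ e k) * f n x ^ (e n - a))"
  define E' where "E' = {e\<in>E. e n = a}"
  have pw: "(\<lambda>x. f n x ^ a) \<in> R" using prems(4) by (auto intro: power)
  have SR: "S \<in> R" unfolding S_def
    using prems(4) by (intro sum mult const prod power) auto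
  have "f n x ^ a * S x = 0" if "x \<in> Z (Suc n)" for x
  proof -
    have "f n x ^ a * S x = (\<Sum>e\<in>E. c e * (\<Prod>k<n. f k x ^ e k) * (f n x ^ a * f n x ^ (e n - a)))"
      by (simp add: S_def sum_distrib_left algebra_simps)
    also have "\<dots> = (\<Sum>e\<in>E. c e * (\<Prod>k<Suc n. f k x ^ e k))"
      using a by (intro sum.cong) (auto simp flip: power_add)
    finally show ?thesis using prems(11)[OF that] by simp
  qed
  moreover have "\<not> (\<forall>x\<in>Z (Suc n). f n x ^ a = 0)" using prems(6)[of n] by auto
  ultimately have S0: "S x = 0" if "x \<in> Z (Suc n)" for x
    using prems(3)[of "Suc n", OF _ pw SR] that by blast
  show False
  proof (rule Suc.IH[of E'])
    show "(\<Sum>e\<in>E'. c e * (\<Prod>k<n. f k x ^ e k)) = 0" if x: "x \<in> Z n" for x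
    proof -
      have "S x = (\<Sum>e\<in>E. if e n = a then c e * (\<Prod>k<n. f k x ^ e k) else 0)"
        unfolding S_def using a prems(5)[OF _ x] by (intro sum.cong) (auto simp: le_antisym)
      also have "\<dots> = (\<Sum>e\<in>E'. c e * (\<Prod>k<n. f k x ^ e k))"
        using prems(7) by (simp add: E'_def sum.inter_filter)
      finally show ?thesis using S0 prems(2)[of n] x by auto
    qed
    show "finite E'" "E' \<noteq> {}" using prems(7) \<open>a \<in> _\<close> by (auto simp: E'_def)
    show "c e \<noteq> 0" if "e \<in> E'" for e using that prems(9) by (auto simp: E'_def)
    show "e = e'" if "e \<in> E'" "e' \<in> E'" "\<forall>k<n. e k = e' k" for e e'
      using that prems(10)[of e e'] by (auto simp: E'_def less_Suc_eq)
  qed (use prems in \<open>auto\<close>)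
qed


section \<open>Multihomogeneous polynomials and Zariski closed sets\<close>

text \<open>Multihomogeneity with the degrees exposed: adding two quotients of multihomogeneous polynomials
  requires knowing by what to multiply them.\<close>

definition has_multidegree :: "('m::finite \<Rightarrow> nat) \<Rightarrow> ('m \<times> 'n::finite) cpoly \<Rightarrow> bool" where
  "has_multidegree d p \<longleftrightarrow>
     (\<forall>e\<in>Poly_Mapping.keys p. \<forall>i. (\<Sum>j\<in>UNIV. Poly_Mapping.lookup e (i, j)) = d i)"

lemma multihomogeneous_iff: "multihomogeneous p \<longleftrightarrow> (\<exists>d. has_multidegree d p)"
  by (simp add: multihomogeneous_def has_multidegree_def)

lemma has_multidegree_add:
  "has_multidegree d p \<Longrightarrow> has_multidegree d q \<Longrightarrow> has_multidegree d (p + q)"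
  unfolding has_multidegree_def using keys_add[of p q] by blast

lemma has_multidegree_mult:
  "has_multidegree d p \<Longrightarrow> has_multidegree d' q \<Longrightarrow> has_multidegree (\<lambda>i. d i + d' i) (p * q)"
  unfolding has_multidegree_def using keys_mult[of p q] by (force simp: lookup_add sum.distrib)

lemma has_multidegree_const: "has_multidegree (\<lambda>_. 0) (Poly_Mapping.single 0 c)"
  by (simp add: has_multidegree_def)

lemma has_multidegree_1: "has_multidegree (\<lambda>_. 0) 1"
  by (simp add: has_multidegree_def)

lemma has_multidegree_var: "has_multidegree (\<lambda>k. of_bool (k = i)) (poly_var (i, j))"
proof -
  have "(\<Sum>l\<in>UNIV. Poly_Mapping.lookup (Poly_Mapping.single (i, j) (1::nat)) (k, l)) = of_bool (k = i)" for k
  proof -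
    have "(\<Sum>l\<in>UNIV. Poly_Mapping.lookup (Poly_Mapping.single (i, j) (1::nat)) (k, l))
        = (\<Sum>l\<in>UNIV. if l = j then of_bool (k = i) else 0)"
      by (intro sum.cong) (auto simp: lookup_single when_def)
    then show ?thesis by simp
  qed
  then show ?thesis by (auto simp: has_multidegree_def poly_var_def)
qed

lemma has_multidegree_power: "has_multidegree d p \<Longrightarrow> has_multidegree (\<lambda>i. n * d i) (p ^ n)"
  by (induction n) (auto simp: has_multidegree_1 dest: has_multidegree_mult)

lemma has_multidegree_prod:
  "finite K \<Longrightarrow> (\<And>k. k \<in> K \<Longrightarrow> has_multidegree (d k) (p k)) \<Longrightarrow>
   has_multidegree (\<lambda>i. \<Sum>k\<in>K. d k i) (\<Prod>k\<in>K. p k)"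
  by (induction K rule: finite_induct) (auto simp: has_multidegree_1 has_multidegree_mult)

lemma has_multidegree_sum:
  "finite K \<Longrightarrow> K \<noteq> {} \<Longrightarrow> (\<And>k. k \<in> K \<Longrightarrow> has_multidegree d (p k)) \<Longrightarrow>
   has_multidegree d (\<Sum>k\<in>K. p k)"
  by (induction K rule: finite_ne_induct) (auto simp: has_multidegree_add)

definition hcoord :: "('m \<Rightarrow> complex^'n) \<Rightarrow> 'm \<times> 'n \<Rightarrow> complex" where
  "hcoord v = (\<lambda>(i, j). v i $ j)"

lemma eval_poly_scale:
  fixes p :: "('m::finite \<times> 'n::finite) cpoly"
  assumes "has_multidegree d p"
  shows "eval_poly p (hcoord (\<lambda>i. k i *s v i)) = (\<Prod>i\<in>UNIV. k i ^ d i) * eval_poly p (hcoord v)"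
proof -
  have "(\<Prod>u\<in>UNIV. hcoord (\<lambda>i. k i *s v i) u ^ Poly_Mapping.lookup e u)
      = (\<Prod>i\<in>UNIV. k i ^ d i) * (\<Prod>u\<in>UNIV. hcoord v u ^ Poly_Mapping.lookup e u)"
    if e: "e \<in> Poly_Mapping.keys p" for e
  proof -
    have "(\<Prod>u\<in>UNIV. hcoord (\<lambda>i. k i *s v i) u ^ Poly_Mapping.lookup e u)
        = (\<Prod>u\<in>UNIV. k (fst u) ^ Poly_Mapping.lookup e u) *
          (\<Prod>u\<in>UNIV. hcoord v u ^ Poly_Mapping.lookup e u)"
      by (simp add: hcoord_def case_prod_beta power_mult_distrib prod.distrib)
    also have "(\<Prod>u\<in>UNIV. k (fst u) ^ Poly_Mapping.lookup e u)
        = (\<Prod>i\<in>UNIV. \<Prod>j\<in>UNIV. k i ^ Poly_Mapping.lookup e (i, j))"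
      by (simp add: prod.cartesian_product case_prod_beta)
    also have "\<dots> = (\<Prod>i\<in>UNIV. k i ^ d i)"
      using assms e by (simp add: has_multidegree_def flip: power_sum)
    finally show ?thesis .
  qed
  then show ?thesis
    by (simp add: eval_poly_def sum_distrib_left mult.left_commute)
qed

definition eval_at :: "('m::finite \<times> 'n::finite) cpoly \<Rightarrow> ('m \<Rightarrow> 'n proj) \<Rightarrow> complex" where
  "eval_at p X = eval_poly p (hcoord (\<lambda>i. rep_proj (X i)))"

definition point :: "('m \<Rightarrow> complex^'n) \<Rightarrow> 'm \<Rightarrow> 'n::finite proj" where
  "point v = (\<lambda>i. abs_proj (v i))"

lemma eval_at_mult: "eval_at (p * q) X = eval_at p X * eval_at q X"
  by (simp add: eval_at_def eval_poly_mult)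

lemma zero_locus_eq: "zero_locus S = {X. \<forall>p\<in>S. eval_at p X = 0}"
  by (simp add: zero_locus_def eval_at_def hcoord_def)

lemma proj_rel_refl: "v \<noteq> 0 \<Longrightarrow> proj_rel v v"
  by (auto simp: proj_rel_def intro: exI[of _ 1])

lemma rep_proj_nonzero: "rep_proj x \<noteq> 0"
  using Quotient3_rep_reflp[OF Quotient3_proj] by (auto simp: proj_rel_def)

lemma abs_rep_proj: "abs_proj (rep_proj x) = x"
  by (rule Quotient3_abs_rep[OF Quotient3_proj])

lemma abs_proj_eq_iff:
  assumes "v \<noteq> 0" "w \<noteq> 0"
  shows "abs_proj v = abs_proj w \<longleftrightarrow> (\<exists>k. w = k *s v)"
proof -
  have "abs_proj v = abs_proj w \<longleftrightarrow> proj_rel v w"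
    using Quotient3_rel[OF Quotient3_proj, of v w] proj_rel_refl[OF assms(1)] proj_rel_refl[OF assms(2)]
    by simp
  then show ?thesis using assms by (simp add: proj_rel_def)
qed

lemma rep_abs_proj:
  assumes "v \<noteq> 0"
  shows "\<exists>k. k \<noteq> 0 \<and> rep_proj (abs_proj v) = k *s v"
proof -
  obtain k where k: "rep_proj (abs_proj v) = k *s v"
    using iffD1[OF abs_proj_eq_iff[OF assms rep_proj_nonzero] abs_rep_proj[symmetric]] by (rule exE)
  then have "k \<noteq> 0" using rep_proj_nonzero[of "abs_proj v"] by auto
  with k show ?thesis by blast
qed

lemma rep_point:
  assumes "\<And>i. v i \<noteq> 0"
  shows "\<exists>k. (\<forall>i. k i \<noteq> 0) \<and> (\<lambda>i. rep_proj (point v i)) = (\<lambda>i. k i *s v i)"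
proof -
  have "\<forall>i. \<exists>k. k \<noteq> 0 \<and> rep_proj (abs_proj (v i)) = k *s v i"
    using rep_abs_proj assms by blast
  then obtain k where "\<forall>i. k i \<noteq> 0 \<and> rep_proj (abs_proj (v i)) = k i *s v i" by metis
  then show ?thesis by (auto simp: point_def)
qed

lemma eval_at_point_eq_0_iff:
  assumes "multihomogeneous p" "\<And>i. v i \<noteq> 0"
  shows "eval_at p (point v) = 0 \<longleftrightarrow> eval_poly p (hcoord v) = 0"
proof -
  obtain d where d: "has_multidegree d p" using assms(1) by (auto simp: multihomogeneous_iff)
  obtain k where "\<forall>i. k i \<noteq> 0" "(\<lambda>i. rep_proj (point v i)) = (\<lambda>i. k i *s v i)"
    using rep_point[of v, OF assms(2)] by blast
  with eval_poly_scale[OF d, of k v] show ?thesis by (simp add: eval_at_def)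
qed

lemma closedin_vanishing: "multihomogeneous p \<Longrightarrow> closedin zariski {X. eval_at p X = 0}"
  unfolding closedin_zariski algebraic_set_def by (intro exI[of _ "{p}"]) (auto simp: zero_locus_eq)

lemma separating_polynomial:
  assumes "closedin zariski Z" "X \<notin> Z"
  obtains p where "multihomogeneous p" "\<And>Y. Y \<in> Z \<Longrightarrow> eval_at p Y = 0" "eval_at p X \<noteq> 0"
  using assms unfolding closedin_zariski algebraic_set_def by (auto simp: zero_locus_eq)

lemma vanishing_on_closure:
  assumes "multihomogeneous p" "\<And>Y. Y \<in> A \<Longrightarrow> eval_at p Y = 0" "X \<in> zariski closure_of A"
  shows "eval_at p X = 0"
  using closure_of_minimal[OF _ closedin_vanishing[OF assms(1)], of A] assms(2,3) by auto

text \<open>Two proper closed subsets that cover \<open>Z\<close> can be enlarged to zero sets in \<open>Z\<close> of single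
  polynomials without becoming all of \<open>Z\<close>, so irreducibility says that the
  polynomials vanishing on the set form a prime ideal.\<close>

lemma irreducible_iff_prime:
  assumes "closedin zariski Z"
  shows "irreducible_space (subtopology zariski Z) \<longleftrightarrow> Z \<noteq> {} \<and>
    (\<forall>p q. multihomogeneous p \<longrightarrow> multihomogeneous q \<longrightarrow>
       (\<forall>X\<in>Z. eval_at p X * eval_at q X = 0) \<longrightarrow>
       (\<forall>X\<in>Z. eval_at p X = 0) \<or> (\<forall>X\<in>Z. eval_at q X = 0))"
    (is "_ \<longleftrightarrow> _ \<and> ?prime")
proof -
  have closed: "closedin (subtopology zariski Z) A \<longleftrightarrow> closedin zariski A \<and> A \<subseteq> Z" for A
    using closedin_closed_subtopology[OF assms] .
  have split: "(\<exists>A B. closedin (subtopology zariski Z) A \<and> closedin (subtopology zariski Z) B \<and>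
      A \<noteq> Z \<and> B \<noteq> Z \<and> A \<union> B = Z) \<longleftrightarrow> \<not> ?prime" (is "?split \<longleftrightarrow> _")
  proof
    assume ?split
    then obtain A B X Y where AB: "closedin zariski A" "closedin zariski B" "A \<union> B = Z"
      "X \<in> Z" "X \<notin> A" "Y \<in> Z" "Y \<notin> B" unfolding closed by blast
    obtain p where p: "multihomogeneous p" "\<And>Y. Y \<in> A \<Longrightarrow> eval_at p Y = 0" "eval_at p X \<noteq> 0"
      using separating_polynomial[OF AB(1,5)] by blast
    obtain q where q: "multihomogeneous q" "\<And>X. X \<in> B \<Longrightarrow> eval_at q X = 0" "eval_at q Y \<noteq> 0"
      using separating_polynomial[OF AB(2,7)] by blast
    have "\<forall>X\<in>Z. eval_at p X * eval_at q X = 0" using p(2) q(2) AB(3) by auto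
    then show "\<not> ?prime" using p(1,3) q(1,3) AB(4,6) by blast
  next
    assume "\<not> ?prime"
    then obtain p q where pq: "multihomogeneous p" "multihomogeneous q"
      "\<forall>X\<in>Z. eval_at p X * eval_at q X = 0"
      "\<exists>X\<in>Z. eval_at p X \<noteq> 0" "\<exists>X\<in>Z. eval_at q X \<noteq> 0" by blast
    have "closedin zariski (Z \<inter> {X. eval_at p X = 0})" "closedin zariski (Z \<inter> {X. eval_at q X = 0})"
      using pq closedin_vanishing assms by (auto intro: closedin_Int)
    with pq(3-) show ?split unfolding closed
      by (intro exI[of _ "Z \<inter> {X. eval_at p X = 0}"] exI[of _ "Z \<inter> {X. eval_at q X = 0}"]) auto
  qed
  have "topspace (subtopology zariski Z) = Z" by simp
  then show ?thesis unfolding irreducible_space_def by (simp only: split not_not)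
qed


section \<open>Closures of parametrized sets\<close>

text \<open>Closed sets contain the points of an algebraic curve at which a generic point of the curve lies
  in them. The curve is given by representatives, which may vanish at special parameters, and
  membership is known where the auxiliary polynomial \<open>f\<close> and all representatives are nonzero.\<close>

lemma limit_of_curve_in_closed:
  fixes \<psi> :: "complex \<Rightarrow> 'm::finite \<Rightarrow> complex^'n"
  assumes W: "closedin zariski W"
    and \<psi>: "\<And>i j. (\<lambda>t. \<psi> t i $ j) \<in> range poly"
    and f: "f \<in> range poly" "f t1 \<noteq> 0"
    and in_W: "\<And>t. f t \<noteq> 0 \<Longrightarrow> \<forall>i. \<psi> t i \<noteq> 0 \<Longrightarrow> point (\<psi> t) \<in> W"
    and \<psi>0: "\<And>i. \<psi> t0 i \<noteq> 0"
  shows "point (\<psi> t0) \<in> W"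
proof (rule ccontr)
  assume "point (\<psi> t0) \<notin> W"
  then obtain p where p: "multihomogeneous p" "\<And>Y. Y \<in> W \<Longrightarrow> eval_at p Y = 0"
    "eval_at p (point (\<psi> t0)) \<noteq> 0"
    using separating_polynomial[OF W] by blast
  have "\<forall>i. \<exists>j. \<psi> t0 i $ j \<noteq> 0" using \<psi>0 by (metis vec_eq_iff zero_index)
  then obtain j where j: "\<And>i. \<psi> t0 i $ j i \<noteq> 0" by metis
  define g where "g = (\<lambda>t. eval_poly p (hcoord (\<psi> t)))"
  define F where "F = {f, g} \<union> range (\<lambda>i t. \<psi> t i $ j i)"
  have hc: "(\<lambda>t. hcoord (\<psi> t) u) \<in> range poly" for u
    using \<psi> by (simp add: hcoord_def case_prod_beta)
  have "g \<in> range poly"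
    unfolding g_def using univariate.eval_poly[of "\<lambda>u t. hcoord (\<psi> t) u"] hc by simp
  moreover have "g t0 \<noteq> 0" using p(3) eval_at_point_eq_0_iff[OF p(1) \<psi>0] by (simp add: g_def)
  ultimately have "\<exists>t. \<forall>h\<in>F. h t \<noteq> 0"
    using f \<psi> j by (intro common_nonzero) (auto simp: F_def)
  then obtain t where t: "f t \<noteq> 0" "g t \<noteq> 0" "\<And>i. \<psi> t i $ j i \<noteq> 0"
    by (auto simp: F_def)
  have nz: "\<psi> t i \<noteq> 0" for i using t(3)[of i] by auto
  then have "eval_at p (point (\<psi> t)) = 0" using in_W t(1) p(2) by blast
  then show False using t(2) eval_at_point_eq_0_iff[OF p(1) nz] by (simp add: g_def)
qed

text \<open>If two polynomials are nonzero at the images of \<open>a\<close> and of \<open>b\<close> respectively, then along a curve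
  from \<open>a\<close> to \<open>b\<close> both are nonzero at a generic parameter, hence so is their product.\<close>

lemma irreducible_closure_of_parametrized:
  fixes \<phi> :: "'a \<Rightarrow> 'm::finite \<Rightarrow> complex^'n"
  assumes T: "s0 \<in> T" "\<And>i. \<phi> s0 i \<noteq> 0"
    and path: "\<And>a b. a \<in> T \<Longrightarrow> b \<in> T \<Longrightarrow> \<exists>\<gamma>. \<gamma> 0 = a \<and> \<gamma> 1 = b \<and> range \<gamma> \<subseteq> T \<and>
        (\<forall>i j. (\<lambda>t. \<phi> (\<gamma> t) i $ j) \<in> range poly)"
  shows "irreducible_variety (zariski closure_of {point (\<phi> s) |s. s \<in> T \<and> (\<forall>i. \<phi> s i \<noteq> 0)})"
    (is "irreducible_variety (_ closure_of ?A)")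
proof -
  let ?W = "zariski closure_of ?A"
  have sub: "?A \<subseteq> ?W" by (rule closure_of_subset) auto
  have on_closure: "\<forall>X\<in>?W. eval_at r X = 0"
    if "multihomogeneous r" "\<forall>X\<in>?A. eval_at r X = 0" for r
    using vanishing_on_closure[OF that(1) bspec[OF that(2)]] by (rule ballI)
  have "(\<forall>X\<in>?W. eval_at p X = 0) \<or> (\<forall>X\<in>?W. eval_at q X = 0)"
    if p: "multihomogeneous p" and q: "multihomogeneous q"
      and pq: "\<forall>X\<in>?W. eval_at p X * eval_at q X = 0" for p q
  proof (rule ccontr)
    assume "\<not> ?thesis"
    then have not_W: "\<not> (\<forall>X\<in>?W. eval_at p X = 0)" "\<not> (\<forall>X\<in>?W. eval_at q X = 0)" by auto
    have "\<not> (\<forall>X\<in>?A. eval_at p X = 0)"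
      using not_W(1) on_closure[OF p] by (rule contrapos_nn)
    moreover have "\<not> (\<forall>X\<in>?A. eval_at q X = 0)"
      using not_W(2) on_closure[OF q] by (rule contrapos_nn)
    ultimately obtain a b where a: "a \<in> T" "\<And>i. \<phi> a i \<noteq> 0" "eval_at p (point (\<phi> a)) \<noteq> 0"
      and b: "b \<in> T" "\<And>i. \<phi> b i \<noteq> 0" "eval_at q (point (\<phi> b)) \<noteq> 0" by auto
    obtain \<gamma> where \<gamma>: "\<gamma> 0 = a" "\<gamma> 1 = b" "range \<gamma> \<subseteq> T"
      "\<And>i j. (\<lambda>t. \<phi> (\<gamma> t) i $ j) \<in> range poly"
      using path[OF a(1) b(1)] by blast
    have hc: "(\<lambda>t. hcoord (\<phi> (\<gamma> t)) u) \<in> range poly" for u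
      using \<gamma>(4) by (simp add: hcoord_def case_prod_beta)
    define f where "f = (\<lambda>t. eval_poly p (hcoord (\<phi> (\<gamma> t))))"
    have f: "f \<in> range poly"
      unfolding f_def using univariate.eval_poly[of "\<lambda>u t. hcoord (\<phi> (\<gamma> t)) u"] hc by simp
    have "f 0 \<noteq> 0" using a(3) eval_at_point_eq_0_iff[OF p a(2)] by (simp add: f_def \<gamma>)
    have "point (\<phi> (\<gamma> 1)) \<in> {X. eval_at q X = 0}"
    proof (rule limit_of_curve_in_closed[OF closedin_vanishing[OF q] \<gamma>(4) f \<open>f 0 \<noteq> 0\<close>])
      fix t assume t: "f t \<noteq> 0" "\<forall>i. \<phi> (\<gamma> t) i \<noteq> 0"
      have "eval_at p (point (\<phi> (\<gamma> t))) \<noteq> 0"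
        using t eval_at_point_eq_0_iff[OF p, of "\<phi> (\<gamma> t)"] by (simp add: f_def)
      moreover have "point (\<phi> (\<gamma> t)) \<in> ?W" using sub t(2) \<gamma>(3) by blast
      ultimately show "point (\<phi> (\<gamma> t)) \<in> {X. eval_at q X = 0}" using pq by auto
    qed (use b(2) \<gamma>(2) in auto)
    then show False using b(3) \<gamma>(2) by simp
  qed
  moreover have "?W \<noteq> {}" using sub T by blast
  ultimately show ?thesis
    unfolding irreducible_variety_def by (subst irreducible_iff_prime) auto
qed


section \<open>Affine charts\<close>

definition chart :: "('m \<Rightarrow> 'n) \<Rightarrow> ('m \<Rightarrow> 'n::finite proj) set" where
  "chart j = {X. \<forall>i. rep_proj (X i) $ j i \<noteq> 0}"

definition affine_coord :: "('m \<Rightarrow> 'n) \<Rightarrow> ('m \<Rightarrow> 'n::finite proj) \<Rightarrow> 'm \<times> 'n \<Rightarrow> complex" where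
  "affine_coord j X = hcoord (\<lambda>i. (1 / rep_proj (X i) $ j i) *s rep_proj (X i))"

text \<open>The regular functions on a chart. Requiring multihomogeneous representatives keeps the zero set of
  such a function the trace of a Zariski closed set; adding two of them then needs
  \<open>chart_monomial\<close>, which has any prescribed multidegree and equals 1 in affine coordinates.\<close>

definition chart_functions ::
    "('m::finite \<Rightarrow> 'n::finite) \<Rightarrow> (('m \<Rightarrow> 'n proj) \<Rightarrow> complex) set" where
  "chart_functions j =
     {f. \<exists>p. multihomogeneous p \<and> (\<forall>X\<in>chart j. f X = eval_poly p (affine_coord j X))}"

definition chart_monomial :: "('m \<Rightarrow> 'n) \<Rightarrow> ('m \<Rightarrow> nat) \<Rightarrow> ('m::finite \<times> 'n) cpoly" where
  "chart_monomial j d = (\<Prod>i\<in>UNIV. poly_var (i, j i) ^ d i)"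

lemma has_multidegree_chart_monomial: "has_multidegree d (chart_monomial j d)"
proof -
  have "has_multidegree (\<lambda>k. \<Sum>i\<in>UNIV. d i * of_bool (k = i)) (chart_monomial j d)"
    unfolding chart_monomial_def
    by (intro has_multidegree_prod has_multidegree_power has_multidegree_var) auto
  moreover have "(\<lambda>k. \<Sum>i\<in>UNIV. d i * of_bool (k = i)) = d" by simp
  ultimately show ?thesis by simp
qed

lemma eval_chart_monomial: "eval_poly (chart_monomial j d) (hcoord v) = (\<Prod>i\<in>UNIV. v i $ j i ^ d i)"
  by (simp add: chart_monomial_def eval_poly_prod eval_poly_power hcoord_def)

lemma eval_chart_monomial_affine_coord:
  "X \<in> chart j \<Longrightarrow> eval_poly (chart_monomial j d) (affine_coord j X) = 1"
  by (simp add: affine_coord_def eval_chart_monomial chart_def)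

lemma eval_affine_coord_eq_0_iff:
  assumes "multihomogeneous p" "X \<in> chart j"
  shows "eval_poly p (affine_coord j X) = 0 \<longleftrightarrow> eval_at p X = 0"
proof -
  obtain d where d: "has_multidegree d p" using assms(1) by (auto simp: multihomogeneous_iff)
  show ?thesis
    using eval_poly_scale[OF d, of "\<lambda>i. 1 / rep_proj (X i) $ j i"] assms(2)
    by (simp add: affine_coord_def eval_at_def chart_def)
qed

lemma eval_affine_coord_point:
  assumes "has_multidegree d p" "\<And>i. v i $ j i \<noteq> 0"
  shows "point v \<in> chart j"
    and "eval_poly p (affine_coord j (point v)) =
      eval_poly p (hcoord v) / eval_poly (chart_monomial j d) (hcoord v)"
proof -
  have nz: "v i \<noteq> 0" for i using assms(2)[of i] by auto
  obtain k where k: "\<forall>i. k i \<noteq> 0" "(\<lambda>i. rep_proj (point v i)) = (\<lambda>i. k i *s v i)"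
    using rep_point[of v, OF nz] by blast
  have rep: "rep_proj (point v i) = k i *s v i" for i using fun_cong[OF k(2), of i] .
  show "point v \<in> chart j" using k assms(2) by (simp add: chart_def rep)
  have "affine_coord j (point v) = hcoord (\<lambda>i. (1 / v i $ j i) *s v i)"
    using k assms(2) by (simp add: affine_coord_def rep)
  then show "eval_poly p (affine_coord j (point v)) =
      eval_poly p (hcoord v) / eval_poly (chart_monomial j d) (hcoord v)"
    using eval_poly_scale[OF assms(1), of "\<lambda>i. 1 / v i $ j i" v]
    by (simp add: eval_chart_monomial power_one_over prod_dividef)
qed

lemma function_algebra_chart_functions:
  "function_algebra (chart_functions (j :: 'm::finite \<Rightarrow> 'n::finite))"
proof
  show "(\<lambda>_. c) \<in> chart_functions j" for c
    unfolding chart_functions_def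
    using has_multidegree_const[of c]
    by (auto simp: multihomogeneous_iff eval_poly_const intro!: exI[of _ "Poly_Mapping.single 0 c"])
next
  fix f g assume "f \<in> chart_functions j" "g \<in> chart_functions j"
  then obtain p q d d' where p: "has_multidegree d p"
      "\<And>X. X \<in> chart j \<Longrightarrow> f X = eval_poly p (affine_coord j X)"
    and q: "has_multidegree d' q" "\<And>X. X \<in> chart j \<Longrightarrow> g X = eval_poly q (affine_coord j X)"
    unfolding chart_functions_def multihomogeneous_iff by auto
  have "has_multidegree (\<lambda>i. d i + d' i) (p * q)" using p q by (auto intro: has_multidegree_mult)
  then show "(\<lambda>x. f x * g x) \<in> chart_functions j"
    unfolding chart_functions_def multihomogeneous_iff using p(2) q(2)
    by (auto intro!: exI[of _ "p * q"] simp: eval_poly_mult)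
  let ?r = "p * chart_monomial j d' + chart_monomial j d * q"
  have "has_multidegree (\<lambda>i. d i + d' i) ?r"
    using p q by (intro has_multidegree_add has_multidegree_mult has_multidegree_chart_monomial)
  then show "(\<lambda>x. f x + g x) \<in> chart_functions j"
    unfolding chart_functions_def multihomogeneous_iff using p(2) q(2)
    by (auto intro!: exI[of _ ?r] simp: eval_poly_mult eval_poly_add eval_chart_monomial_affine_coord)
qed

lemma eval_at_chart_monomial_eq_0_iff:
  "eval_at (chart_monomial j (\<lambda>_. 1)) X = 0 \<longleftrightarrow> X \<notin> chart j"
  by (simp add: eval_at_def eval_chart_monomial chart_def)

lemma multihomogeneous_chart_monomial: "multihomogeneous (chart_monomial j d)"
  using has_multidegree_chart_monomial multihomogeneous_iff by blast

text \<open>The chart is dense in every irreducible set that it meets.\<close>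

lemma vanishing_off_chart:
  assumes Z: "irreducible_variety Z" and "Z \<inter> chart j \<noteq> {}"
    and p: "multihomogeneous p" "\<And>X. X \<in> Z \<inter> chart j \<Longrightarrow> eval_at p X = 0" and "X \<in> Z"
  shows "eval_at p X = 0"
proof -
  have "\<forall>X\<in>Z. eval_at p X * eval_at (chart_monomial j (\<lambda>_. 1)) X = 0"
    using p(2) eval_at_chart_monomial_eq_0_iff by fastforce
  then have "(\<forall>X\<in>Z. eval_at p X = 0) \<or> (\<forall>X\<in>Z. eval_at (chart_monomial j (\<lambda>_. 1)) X = 0)"
    using Z p(1) multihomogeneous_chart_monomial irreducible_iff_prime
    unfolding irreducible_variety_def by blast
  then show ?thesis using assms(2,5) eval_at_chart_monomial_eq_0_iff by blast
qed

lemma chart_functions_prime: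
  assumes Z: "irreducible_variety Z" and "f \<in> chart_functions j" "g \<in> chart_functions j"
    and fg: "\<forall>X\<in>Z \<inter> chart j. f X * g X = 0"
  shows "(\<forall>X\<in>Z \<inter> chart j. f X = 0) \<or> (\<forall>X\<in>Z \<inter> chart j. g X = 0)"
proof (cases "Z \<inter> chart j = {}")
  case False
  obtain p where p: "multihomogeneous p" "\<And>X. X \<in> chart j \<Longrightarrow> f X = 0 \<longleftrightarrow> eval_at p X = 0"
    using assms(2) unfolding chart_functions_def by (auto simp: eval_affine_coord_eq_0_iff)
  obtain q where q: "multihomogeneous q" "\<And>X. X \<in> chart j \<Longrightarrow> g X = 0 \<longleftrightarrow> eval_at q X = 0"
    using assms(3) unfolding chart_functions_def by (auto simp: eval_affine_coord_eq_0_iff)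
  have "eval_at (p * q) X = 0" if "X \<in> Z" for X
    using vanishing_off_chart[OF Z False multihomogeneous_mult[OF p(1) q(1)] _ that] fg p(2) q(2)
    by (auto simp: eval_at_mult)
  then have "(\<forall>X\<in>Z. eval_at p X = 0) \<or> (\<forall>X\<in>Z. eval_at q X = 0)"
    using Z p(1) q(1) irreducible_iff_prime unfolding irreducible_variety_def eval_at_mult by blast
  then show ?thesis using p(2) q(2) by auto
qed auto


section \<open>The dimension of a parametrized variety\<close>

text \<open>A chain of irreducible sets of length \<open>n\<close> provides \<open>n\<close> functions on a chart that meets the
  smallest of them, and these functions admit no algebraic relation. Pulled back along the
  parametrization, they are quotients of polynomials in \<open>CARD('v)\<close> variables with a common
  denominator, and more than \<open>CARD('v)\<close> of those do admit one.\<close>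

theorem variety_dim_parametrized_le:
  fixes \<phi> :: "('v::finite \<Rightarrow> complex) \<Rightarrow> 'm::finite \<Rightarrow> complex^'n"
  assumes \<phi>: "\<And>i j. (\<lambda>s. \<phi> s i $ j) \<in> range eval_poly"
  shows "variety_dim (zariski closure_of {point (\<phi> s) |s. \<forall>i. \<phi> s i \<noteq> 0}) \<le> enat CARD('v)"
    (is "variety_dim (_ closure_of ?A) \<le> _")
proof -
  define A where "A = ?A"
  define V where "V = zariski closure_of A"
  have no_chain: False if n: "CARD('v) < n"
    and Z: "\<And>i. i \<le> n \<Longrightarrow> closedin (subtopology zariski V) (Z i)"
      "\<And>i. i \<le> n \<Longrightarrow> irreducible_space (subtopology (subtopology zariski V) (Z i))"
    and strict: "\<And>i. i < n \<Longrightarrow> Z i \<subset> Z (Suc i)" for n Z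
  proof -
    have "closedin zariski V" by (simp add: V_def)
    then have closed: "closedin zariski (Z i)" "Z i \<subseteq> V" if "i \<le> n" for i
      using Z(1)[OF that] by (auto simp: closedin_closed_subtopology)
    have irr: "irreducible_variety (Z i)" if "i \<le> n" for i
      using Z(2)[OF that] closed[OF that]
      by (simp add: irreducible_variety_def subtopology_subtopology Int_absorb1)
    have "Z 0 \<noteq> {}"
      using Z(2)[of 0] closed(2)[of 0] by (auto simp: irreducible_space_def)
    then obtain X0 where X0: "X0 \<in> Z 0" by auto
    have "\<forall>i. \<exists>j. rep_proj (X0 i) $ j \<noteq> 0"
      using rep_proj_nonzero by (metis vec_eq_iff zero_index)
    then obtain j where "\<And>i. rep_proj (X0 i) $ j i \<noteq> 0" by metis
    then have X0_chart: "X0 \<in> chart j" by (simp add: chart_def)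
    have X0_in: "X0 \<in> Z k" if "k \<le> n" for k
      using that by (induction k) (use X0 strict[THEN psubset_imp_subset] in \<open>auto simp: Suc_le_eq\<close>)
    interpret function_algebra "chart_functions j" by (rule function_algebra_chart_functions)

    have "\<exists>p d. has_multidegree d p \<and> (\<forall>X\<in>Z k. eval_at p X = 0) \<and>
        (\<exists>X\<in>Z (Suc k). eval_at p X \<noteq> 0)" if k: "k < n" for k
    proof -
      obtain Y where Y: "Y \<in> Z (Suc k)" "Y \<notin> Z k" using strict[OF k] by auto
      obtain p where "multihomogeneous p" "\<And>X. X \<in> Z k \<Longrightarrow> eval_at p X = 0" "eval_at p Y \<noteq> 0"
        using separating_polynomial[OF closed(1) Y(2)] k by (metis less_imp_le)
      with Y show ?thesis by (auto simp: multihomogeneous_iff)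
    qed
    then obtain P d where P: "\<And>k. k < n \<Longrightarrow> has_multidegree (d k) (P k)"
      "\<And>k X. k < n \<Longrightarrow> X \<in> Z k \<Longrightarrow> eval_at (P k) X = 0"
      "\<And>k. k < n \<Longrightarrow> \<exists>X\<in>Z (Suc k). eval_at (P k) X \<noteq> 0" by metis
    have mP: "multihomogeneous (P k)" if "k < n" for k
      using P(1)[OF that] by (auto simp: multihomogeneous_iff)
    define f where "f = (\<lambda>k X. eval_poly (P k) (affine_coord j X))"
    have f_in: "f k \<in> chart_functions j" if "k < n" for k
      using mP[OF that] by (auto simp: f_def chart_functions_def)

    have pullback: "\<exists>q. \<forall>s. eval_poly q s = eval_poly p (hcoord (\<phi> s))" for p
    proof -
      have "(\<lambda>s. hcoord (\<phi> s) u) \<in> range eval_poly" for u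
        using \<phi> by (simp add: hcoord_def case_prod_beta)
      then have "(\<lambda>s. eval_poly p (hcoord (\<phi> s))) \<in> range eval_poly"
        using multivariate.eval_poly[of "\<lambda>u s. hcoord (\<phi> s) u" p] by simp
      then show ?thesis by (metis imageE)
    qed
    have "\<forall>k. \<exists>q. \<forall>s. eval_poly q s = eval_poly (P k) (hcoord (\<phi> s))" using pullback by blast
    then obtain G where G: "\<And>k s. eval_poly (G k) s = eval_poly (P k) (hcoord (\<phi> s))" by metis
    have "\<forall>k. \<exists>q. \<forall>s. eval_poly q s = eval_poly (chart_monomial j (d k)) (hcoord (\<phi> s))"
      using pullback by blast
    then obtain H where
      H: "\<And>k s. eval_poly (H k) s = eval_poly (chart_monomial j (d k)) (hcoord (\<phi> s))" by metis
    \<comment> \<open>The pullback of \<open>f k\<close> is \<open>G k / H k\<close>, brought here to the common denominator \<open>h\<close>.\<close>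
    define h where "h = (\<Prod>k<n. H k)"
    define g where "g = (\<lambda>k. G k * (\<Prod>l\<in>{..<n} - {k}. H l))"
    have quot: "eval_poly h s \<noteq> 0 \<and> (\<forall>k<n. f k (point (\<phi> s)) = eval_poly (g k) s / eval_poly h s)"
      if s: "\<And>i. \<phi> s i $ j i \<noteq> 0" for s
    proof (intro conjI allI impI)
      have Hn: "eval_poly (H k) s \<noteq> 0" for k using s by (simp add: H eval_chart_monomial)
      then show "eval_poly h s \<noteq> 0" by (simp add: h_def eval_poly_prod)
      fix k assume k: "k < n"
      have "eval_poly h s = eval_poly (H k) s * eval_poly (\<Prod>l\<in>{..<n} - {k}. H l) s"
        unfolding h_def using k by (subst prod.remove[of _ k]) (auto simp: eval_poly_mult)
      moreover have "eval_poly (\<Prod>l\<in>{..<n} - {k}. H l) s \<noteq> 0"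
        using Hn by (simp add: eval_poly_prod)
      ultimately show "f k (point (\<phi> s)) = eval_poly (g k) s / eval_poly h s"
        using eval_affine_coord_point(2)[OF P(1)[OF k], of "\<phi> s" j] s Hn
        by (simp add: f_def g_def G H eval_poly_mult)
    qed
    obtain D c where c: "\<exists>e\<in>PiE {..<n} (\<lambda>_. {..D}). c e \<noteq> 0"
      "\<And>s. (\<Sum>e\<in>PiE {..<n} (\<lambda>_. {..D}). c e *
         (\<Prod>k<n. eval_poly (g k) s ^ e k * eval_poly h s ^ (D - e k))) = 0"
      using algebraic_dependence[OF n, of g h] by blast
    define B where "B = PiE {..<n} (\<lambda>_. {..D})"
    define E where "E = {e\<in>B. c e \<noteq> 0}"
    have finB: "finite B" unfolding B_def by (intro finite_PiE) auto
    define F where "F = (\<lambda>X. \<Sum>e\<in>E. c e * (\<Prod>k<n. f k X ^ e k))"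
    have F_param: "F (point (\<phi> s)) = 0" if s: "\<And>i. \<phi> s i $ j i \<noteq> 0" for s
    proof -
      have h0: "eval_poly h s \<noteq> 0" and fk: "\<And>k. k < n \<Longrightarrow>
          f k (point (\<phi> s)) = eval_poly (g k) s / eval_poly h s" using quot[OF s] by auto
      have *: "(\<Prod>k<n. eval_poly (g k) s ^ e k * eval_poly h s ^ (D - e k)) =
          eval_poly h s ^ (D * n) * (\<Prod>k<n. f k (point (\<phi> s)) ^ e k)" if e: "e \<in> B" for e
      proof -
        have "eval_poly (g k) s ^ e k * eval_poly h s ^ (D - e k)
            = eval_poly h s ^ D * f k (point (\<phi> s)) ^ e k" if k: "k < n" for k
        proof -
          have "e k \<le> D" using e k by (auto simp: B_def)
          then show ?thesis using h0 by (simp add: fk[OF k] power_divide power_diff)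
        qed
        then show ?thesis by (simp add: prod.distrib power_mult)
      qed
      have "F (point (\<phi> s)) = (\<Sum>e\<in>B. c e * (\<Prod>k<n. f k (point (\<phi> s)) ^ e k))"
        unfolding F_def E_def by (intro sum.mono_neutral_left) (use finB in auto)
      then have "eval_poly h s ^ (D * n) * F (point (\<phi> s))
          = (\<Sum>e\<in>B. c e * (\<Prod>k<n. eval_poly (g k) s ^ e k * eval_poly h s ^ (D - e k)))"
        by (simp add: * sum_distrib_left mult.left_commute)
      then show ?thesis using c(2)[of s] h0 by (simp add: B_def)
    qed
    have "F \<in> chart_functions j" unfolding F_def
      using f_in by (intro sum mult const prod power) auto
    then obtain p where p: "multihomogeneous p" "\<And>X. X \<in> chart j \<Longrightarrow> F X = 0 \<longleftrightarrow> eval_at p X = 0"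
      unfolding chart_functions_def by (auto simp: eval_affine_coord_eq_0_iff)
    \<comment> \<open>The relation holds at the parametrized points of the chart. The extra factor vanishes at the
      other ones, so the relation passes to the closure.\<close>
    let ?q = "p * chart_monomial j (\<lambda>_. 1)"
    have q: "multihomogeneous ?q"
      by (intro multihomogeneous_mult p multihomogeneous_chart_monomial)
    have "eval_at ?q Y = 0" if "Y \<in> A" for Y
    proof -
      obtain s where s: "Y = point (\<phi> s)" "\<And>i. \<phi> s i \<noteq> 0"
        using \<open>Y \<in> A\<close> by (auto simp: A_def)
      show ?thesis
      proof (cases "\<forall>i. \<phi> s i $ j i \<noteq> 0")
        case True
        have "Y \<in> chart j"
          unfolding s using eval_affine_coord_point(1)[OF P(1)[OF n]] True n by blast
        then show ?thesis using F_param[of s] True p(2)[of Y] by (simp add: eval_at_mult s)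
      next
        case False
        then show ?thesis using eval_at_point_eq_0_iff[OF q s(2)]
          by (simp add: s eval_poly_mult eval_chart_monomial)
      qed
    qed
    then have on_V: "eval_at ?q X = 0" if "X \<in> V" for X
      using vanishing_on_closure[OF q] that unfolding V_def by blast
    have F0: "F X = 0" if "X \<in> V" "X \<in> chart j" for X
      using on_V[OF that(1)] that(2) p(2)[OF that(2)]
      by (simp add: eval_at_mult eval_at_chart_monomial_eq_0_iff del: One_nat_def)

    show False
    proof (rule no_algebraic_relation_along_chain[of "\<lambda>k. Z k \<inter> chart j" n f E c])
      show "Z 0 \<inter> chart j \<noteq> {}" using X0 X0_chart by auto
      show "Z k \<inter> chart j \<subseteq> Z (Suc k) \<inter> chart j" if "k < n" for k using strict[OF that] by auto
      show "(\<forall>X\<in>Z k \<inter> chart j. u X = 0) \<or> (\<forall>X\<in>Z k \<inter> chart j. w X = 0)"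
        if "k \<le> n" "u \<in> chart_functions j" "w \<in> chart_functions j"
          "\<forall>X\<in>Z k \<inter> chart j. u X * w X = 0" for k u w
        using chart_functions_prime[OF irr] that by blast
      show "f k X = 0" if "k < n" "X \<in> Z k \<inter> chart j" for k X
        using that P(2)[OF that(1)] mP[OF that(1)] by (simp add: f_def eval_affine_coord_eq_0_iff)
      show "\<exists>X\<in>Z (Suc k) \<inter> chart j. f k X \<noteq> 0" if k: "k < n" for k
      proof (rule ccontr)
        assume "\<not> ?thesis"
        then have "eval_at (P k) X = 0" if "X \<in> Z (Suc k) \<inter> chart j" for X
          using that mP[OF k] by (auto simp: f_def eval_affine_coord_eq_0_iff)
        moreover have "Z (Suc k) \<inter> chart j \<noteq> {}" using X0_in[of "Suc k"] X0_chart k by auto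
        ultimately have "eval_at (P k) X = 0" if "X \<in> Z (Suc k)" for X
          using vanishing_off_chart[OF irr _ mP[OF k]] that k by (meson Suc_leI)
        then show False using P(3)[OF k] by blast
      qed
      show "E \<noteq> {}" using c(1) by (auto simp: E_def B_def)
      show "finite E" using finB by (simp add: E_def)
      show "c e \<noteq> 0" if "e \<in> E" for e using that by (simp add: E_def)
      show "e = e'" if "e \<in> E" "e' \<in> E" "\<forall>k<n. e k = e' k" for e e'
        using that by (auto simp: E_def B_def intro: PiE_ext)
      show "(\<Sum>e\<in>E. c e * (\<Prod>k<n. f k X ^ e k)) = 0" if "X \<in> Z n \<inter> chart j" for X
        using F0[of X] that closed(2)[of n] by (auto simp: F_def)
    qed (use f_in in auto)
  qed
  show ?thesis
    unfolding variety_dim_def krull_dim_def V_def[symmetric] A_def[symmetric]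
  proof (rule Sup_least)
    fix x assume "x \<in> {enat n |n. \<exists>Z. (\<forall>i\<le>n. closedin (subtopology zariski V) (Z i) \<and>
        irreducible_space (subtopology (subtopology zariski V) (Z i))) \<and> (\<forall>i<n. Z i \<subset> Z (Suc i))}"
    then obtain n Z where n: "x = enat n" and Z: "\<forall>i\<le>n. closedin (subtopology zariski V) (Z i) \<and>
        irreducible_space (subtopology (subtopology zariski V) (Z i))" "\<forall>i<n. Z i \<subset> Z (Suc i)"
      by blast
    have "\<not> CARD('v) < n" using no_chain[of n Z] Z(1)[rule_format] Z(2)[rule_format] by auto
    then show "x \<le> enat CARD('v)" using n by simp
  qed
qed

text \<open>The images of the coordinate subspaces of the parameter space have irreducible closures. Freeing
  one more coordinate enlarges the closure, because by \<open>sep\<close> the vanishing of that coordinate can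
  be read off from the image.\<close>

theorem variety_dim_parametrized_ge:
  fixes \<phi> :: "('v::finite \<Rightarrow> complex) \<Rightarrow> 'm::finite \<Rightarrow> complex^'n"
  assumes \<phi>: "\<And>i j. (\<lambda>s. \<phi> s i $ j) \<in> range eval_poly"
    and base: "\<And>i. \<phi> (\<lambda>_. 0) i \<noteq> 0"
    and sep: "\<And>v. \<exists>p. multihomogeneous p \<and> (\<forall>s. eval_poly p (hcoord (\<phi> s)) = 0 \<longleftrightarrow> s v = 0)"
  shows "irreducible_variety (zariski closure_of {point (\<phi> s) |s. \<forall>i. \<phi> s i \<noteq> 0})"
    and "enat CARD('v) \<le> variety_dim (zariski closure_of {point (\<phi> s) |s. \<forall>i. \<phi> s i \<noteq> 0})"
proof -
  obtain idx where idx: "bij_betw idx (UNIV :: 'v set) {..<CARD('v)}"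
    using ex_bij_betw_finite_nat[of "UNIV :: 'v set"] by (auto simp: atLeast0LessThan)
  define T where "T = (\<lambda>k. {s :: 'v \<Rightarrow> complex. \<forall>v. k \<le> idx v \<longrightarrow> s v = 0})"
  define A where "A = (\<lambda>k. {point (\<phi> s) |s. s \<in> T k \<and> (\<forall>i. \<phi> s i \<noteq> 0)})"
  define Z where "Z = (\<lambda>k. zariski closure_of A k)"
  have "\<not> CARD('v) \<le> idx v" for v using bij_betw_apply[OF idx, of v] by simp
  then have "T CARD('v) = UNIV" by (simp add: T_def)
  then have A_top: "A CARD('v) = {point (\<phi> s) |s. \<forall>i. \<phi> s i \<noteq> 0}" by (simp add: A_def)
  have A_mono: "A k \<subseteq> A l" if "k \<le> l" for k l using that by (fastforce simp: A_def T_def)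
  have along_curve: "(\<lambda>t. \<phi> (\<gamma> t) i $ j) \<in> range poly"
    if "\<And>v. (\<lambda>t. \<gamma> t v) \<in> range poly" for \<gamma> :: "complex \<Rightarrow> 'v \<Rightarrow> complex" and i j
  proof -
    obtain q where "(\<lambda>s. \<phi> s i $ j) = eval_poly q" using \<phi>[of i j] by auto
    then have "\<phi> (\<gamma> t) i $ j = eval_poly q (\<lambda>v. \<gamma> t v)" for t by metis
    then show ?thesis using univariate.eval_poly[of "\<lambda>v t. \<gamma> t v" q] that by simp
  qed
  have irr: "irreducible_variety (Z k)" for k
    unfolding Z_def A_def
  proof (rule irreducible_closure_of_parametrized[of "\<lambda>_. 0"])
    fix a b assume ab: "a \<in> T k" "b \<in> T k"
    define \<gamma> where "\<gamma> = (\<lambda>t v. (1 - t) * a v + t * b v)"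
    have "(\<lambda>t. \<gamma> t v) \<in> range poly" for v
      unfolding \<gamma>_def
      by (intro univariate.add univariate.mult univariate.diff univariate.const univariate_id)
    moreover have "range \<gamma> \<subseteq> T k" using ab by (auto simp: \<gamma>_def T_def)
    ultimately show "\<exists>\<gamma>. \<gamma> 0 = a \<and> \<gamma> 1 = b \<and> range \<gamma> \<subseteq> T k \<and>
        (\<forall>i j. (\<lambda>t. \<phi> (\<gamma> t) i $ j) \<in> range poly)"
      using along_curve by (intro exI[of _ \<gamma>]) (auto simp: \<gamma>_def)
  qed (use base in \<open>auto simp: T_def\<close>)
  then show "irreducible_variety (zariski closure_of {point (\<phi> s) |s. \<forall>i. \<phi> s i \<noteq> 0})"
    using A_top unfolding Z_def by metis
  have strict: "Z k \<subset> Z (Suc k)" if k: "k < CARD('v)" for k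
  proof -
    obtain v where v: "idx v = k" using idx k by (metis bij_betw_iff_bijections lessThan_iff)
    obtain p where p: "multihomogeneous p" "\<And>s. eval_poly p (hcoord (\<phi> s)) = 0 \<longleftrightarrow> s v = 0"
      using sep[of v] by blast
    have pA: "eval_at p (point (\<phi> s)) = 0 \<longleftrightarrow> s v = 0" if "\<And>i. \<phi> s i \<noteq> 0" for s
      using eval_at_point_eq_0_iff[OF p(1) that] p(2) by simp
    have "\<forall>Y\<in>A k. eval_at p Y = 0" using pA v by (auto simp: A_def T_def)
    then have pZ: "eval_at p X = 0" if "X \<in> Z k" for X
      using vanishing_on_closure[OF p(1), of "A k"] that unfolding Z_def by blast
    define \<gamma> where "\<gamma> = (\<lambda>t :: complex. (\<lambda>_. 0)(v := t))"
    have "(\<lambda>t. \<gamma> t u) \<in> range poly" for u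
      by (cases "u = v") (auto simp: \<gamma>_def univariate_id intro: univariate.const)
    note curve = along_curve[of \<gamma>, OF this]
    have \<gamma>0: "\<gamma> 0 = (\<lambda>_. 0)" by (auto simp: \<gamma>_def)
    have "\<not> Z (Suc k) \<subseteq> {X. eval_at p X = 0}"
    proof
      assume sub: "Z (Suc k) \<subseteq> {X. eval_at p X = 0}"
      have "point (\<phi> (\<gamma> 0)) \<in> {}"
      proof (rule limit_of_curve_in_closed[of "{}" "\<lambda>t. \<phi> (\<gamma> t)" "\<lambda>t. t" 1 0])
        fix t :: complex assume t: "t \<noteq> 0" "\<forall>i. \<phi> (\<gamma> t) i \<noteq> 0"
        have "\<gamma> t \<in> T (Suc k)" using v by (auto simp: \<gamma>_def T_def)
        then have "point (\<phi> (\<gamma> t)) \<in> A (Suc k)" using t(2) unfolding A_def by blast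
        then have "point (\<phi> (\<gamma> t)) \<in> Z (Suc k)"
          unfolding Z_def using closure_of_subset[of "A (Suc k)" zariski] by auto
        then have "\<gamma> t v = 0" using sub pA[of "\<gamma> t"] t(2) by auto
        then show "point (\<phi> (\<gamma> t)) \<in> {}" using t(1) by (simp add: \<gamma>_def)
      qed (use base \<gamma>0 curve univariate_id in auto)
      then show False by simp
    qed
    moreover have "Z k \<subseteq> Z (Suc k)" unfolding Z_def by (intro closure_of_mono A_mono) simp
    ultimately show ?thesis using pZ by blast
  qed
  define V where "V = Z CARD('v)"
  have ZV: "Z k \<subseteq> V" if "k \<le> CARD('v)" for k
    unfolding V_def Z_def using that by (intro closure_of_mono A_mono)
  have "closedin zariski V" by (simp add: V_def Z_def)
  then have "closedin (subtopology zariski V) (Z k) \<and>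
      irreducible_space (subtopology (subtopology zariski V) (Z k))" if "k \<le> CARD('v)" for k
    using irr[of k] ZV[OF that]
    by (simp add: irreducible_variety_def closedin_closed_subtopology subtopology_subtopology Int_absorb1)
  then have "enat CARD('v) \<le> variety_dim V"
    unfolding variety_dim_def krull_dim_def using strict
    by (intro Sup_upper) blast
  then show "enat CARD('v) \<le> variety_dim (zariski closure_of {point (\<phi> s) |s. \<forall>i. \<phi> s i \<noteq> 0})"
    by (simp add: V_def Z_def A_top)
qed


section \<open>Cross products of complex vectors\<close>

definition ccross :: "complex^3 \<Rightarrow> complex^3 \<Rightarrow> complex^3" where
  "ccross u v = vector [u$2 * v$3 - u$3 * v$2, u$3 * v$1 - u$1 * v$3, u$1 * v$2 - u$2 * v$1]"

lemma ccross_component: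
  "ccross u v $ 1 = u$2 * v$3 - u$3 * v$2"
  "ccross u v $ 2 = u$3 * v$1 - u$1 * v$3"
  "ccross u v $ 3 = u$1 * v$2 - u$2 * v$1"
  by (simp_all add: ccross_def)

lemma ccross_combination:
  "ccross (a *s u + b *s v) (c *s u + d *s v) = (a * d - b * c) *s ccross u v"
  by (simp add: vec_eq_iff forall_3 ccross_component algebra_simps)

lemma ccross_eq_0_imp:
  assumes "ccross u v = 0"
  shows "\<exists>a b. (a \<noteq> 0 \<or> b \<noteq> 0) \<and> a *s u + b *s v = 0"
proof (cases "u = 0")
  case True
  then show ?thesis by (intro exI[of _ 1] exI[of _ 0]) auto
next
  case False
  then obtain k where k: "u $ k \<noteq> 0" by (auto simp: vec_eq_iff)
  have eq: "u$2 * v$3 = u$3 * v$2" "u$3 * v$1 = u$1 * v$3" "u$1 * v$2 = u$2 * v$1"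
    using assms by (auto simp: vec_eq_iff forall_3 ccross_component)
  have "v $ k *s u + (- u $ k) *s v = 0"
    using exhaust_3[of k] eq by (auto simp: vec_eq_iff forall_3 algebra_simps)
  then show ?thesis using k by (intro exI[of _ "v $ k"] exI[of _ "- u $ k"]) auto
qed

lemma ccross_eq_0:
  assumes "a \<noteq> 0 \<or> b \<noteq> 0" "a *s u + b *s v = 0"
  shows "ccross u v = 0"
proof -
  have u: "a * u $ i = - b * v $ i" for i
    using arg_cong[OF assms(2), of "\<lambda>w. w $ i"] by (simp add: eq_neg_iff_add_eq_0)
  have "a *s ccross u v = 0" "b *s ccross u v = 0"
    using u[of 1] u[of 2] u[of 3]
    by (simp_all add: vec_eq_iff forall_3 ccross_component) (algebra+)
  then show ?thesis using assms(1) by auto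
qed

text \<open>By the identity \<open>l \<times> (u \<times> v) = (l \<bullet> v) u - (l \<bullet> u) v\<close>, the vectors \<open>l\<close> and \<open>u \<times> v\<close> are parallel.\<close>

lemma orthogonal_to_both_imp_multiple:
  assumes "(\<Sum>j\<in>UNIV. u $ j * l $ j) = 0" "(\<Sum>j\<in>UNIV. v $ j * l $ j) = 0" "ccross u v \<noteq> 0"
  shows "\<exists>k. l = k *s ccross u v"
proof -
  let ?n = "ccross u v"
  obtain k where k: "?n $ k \<noteq> 0" using assms(3) by (auto simp: vec_eq_iff)
  have o: "u$1 * l$1 + u$2 * l$2 + u$3 * l$3 = 0" "v$1 * l$1 + v$2 * l$2 + v$3 * l$3 = 0"
    using assms by (simp_all add: sum_3)
  have "l$1 * ?n$2 = l$2 * ?n$1" "l$1 * ?n$3 = l$3 * ?n$1" "l$2 * ?n$3 = l$3 * ?n$2"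
    unfolding ccross_component using o by algebra+
  then have "l $ i * ?n $ k = l $ k * ?n $ i" for i
    using exhaust_3[of k] exhaust_3[of i] by auto
  then have "l = (l $ k / ?n $ k) *s ?n" using k by (simp add: vec_eq_iff field_simps)
  then show ?thesis ..
qed

text \<open>If \<open>v\<close> and \<open>w\<close> are independent, the coefficients of the relation are cofactors of the matrix with columns \<open>u\<close>, \<open>v\<close>, \<open>w\<close>.\<close>

lemma triple_product_eq_0_imp:
  assumes "(\<Sum>j\<in>UNIV. u $ j * ccross v w $ j) = 0"
  shows "\<exists>a b c. (a \<noteq> 0 \<or> b \<noteq> 0 \<or> c \<noteq> 0) \<and> a *s u + b *s v + c *s w = 0"
proof (cases "ccross v w = 0")
  case True
  then obtain b c where "b \<noteq> 0 \<or> c \<noteq> 0" "b *s v + c *s w = 0" using ccross_eq_0_imp by blast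
  then show ?thesis by (intro exI[of _ 0] exI[of _ b] exI[of _ c]) auto
next
  case False
  then obtain k where k: "ccross v w $ k \<noteq> 0" by (auto simp: vec_eq_iff)
  have "\<forall>k i. ccross v w $ k * u $ i + ccross w u $ k * v $ i + ccross u v $ k * w $ i =
      (if i = k then \<Sum>j\<in>UNIV. u $ j * ccross v w $ j else 0)"
    by (simp add: forall_3 sum_3 ccross_component algebra_simps)
  then have "ccross v w $ k *s u + ccross w u $ k *s v + ccross u v $ k *s w = 0"
    using assms by (simp add: vec_eq_iff)
  then show ?thesis using k by blast
qed


section \<open>Linear algebra of complex four-space\<close>

lemma span_insert_iff: "v \<in> vec.span (insert x S) \<longleftrightarrow> (\<exists>a. \<exists>w\<in>vec.span S. v = a *s x + w)"
  for x :: "complex^'n"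
proof
  assume "v \<in> vec.span (insert x S)"
  then obtain a where "v - a *s x \<in> vec.span S" by (auto simp: vec.span_insert)
  moreover have "v = a *s x + (v - a *s x)" by simp
  ultimately show "\<exists>a. \<exists>w\<in>vec.span S. v = a *s x + w" by blast
next
  assume "\<exists>a. \<exists>w\<in>vec.span S. v = a *s x + w"
  then obtain a w where "w \<in> vec.span S" "v = a *s x + w" by blast
  then have "v - a *s x \<in> vec.span S" by simp
  then show "v \<in> vec.span (insert x S)" by (auto simp: vec.span_insert)
qed

lemma span_pair_iff: "v \<in> vec.span {x, y} \<longleftrightarrow> (\<exists>a b. v = a *s x + b *s y)"
  for x y :: "complex^'n"
  unfolding span_insert_iff[of v x "{y}"] vec.span_singleton by blast

lemma small_span_proper:
  assumes "finite S" "card S < CARD('n)"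
  shows "vec.span S \<noteq> (UNIV :: (complex^'n) set)"
proof
  assume "vec.span S = (UNIV :: (complex^'n) set)"
  then have "CARD('n) \<le> card S" using vec.dim_le_card'[OF assms(1)] vec.dim_span vec_dim_card by metis
  then show False using assms by simp
qed

lemma finite_if_at_most_one:
  assumes "\<And>s t. P s \<Longrightarrow> P t \<Longrightarrow> s = t"
  shows "finite {t. P t}"
proof (cases "\<exists>t. P t")
  case True
  then obtain t where "P t" by auto
  then have "{t. P t} = {t}" using assms by auto
  then show ?thesis by simp
qed simp

text \<open>A line that contains a point outside a subspace meets it in at most one point, and a line has
  infinitely many points. For a further subspace \<open>W0\<close> the line is taken through a point outside the
  previous subspaces in the direction of a vector outside \<open>W0\<close>.\<close>

lemma ex_outside_proper_subspaces:
  fixes \<W> :: "(complex^'n) set set"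
  assumes "finite \<W>" "\<And>W. W \<in> \<W> \<Longrightarrow> vec.subspace W \<and> W \<noteq> UNIV"
  shows "\<exists>v. \<forall>W\<in>\<W>. v \<notin> W"
  using assms
proof (induction \<W> rule: finite_induct)
  case (insert W0 \<W>)
  then obtain v where v: "\<And>W. W \<in> \<W> \<Longrightarrow> v \<notin> W" by auto
  show ?case
  proof (cases "v \<in> W0")
    case False
    with v show ?thesis by blast
  next
    case True
    obtain u where u: "u \<notin> W0" using insert.prems by blast
    have "finite {t. v + t *s u \<in> W}" if W: "W \<in> \<W>" for W
    proof -
      have "vec.subspace W" using insert.prems W by blast
      have "s = t" if "v + s *s u \<in> W" "v + t *s u \<in> W" for s t
      proof (rule ccontr)
        assume "s \<noteq> t"
        have "(v + s *s u) - (v + t *s u) \<in> W"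
          using \<open>vec.subspace W\<close> that by (rule vec.subspace_diff)
        then have "(1 / (s - t)) *s ((v + s *s u) - (v + t *s u)) \<in> W"
          by (rule vec.subspace_scale[OF \<open>vec.subspace W\<close>])
        also have "(1 / (s - t)) *s ((v + s *s u) - (v + t *s u)) = u"
        proof -
          have diff: "(v + s *s u) - (v + t *s u) = (s - t) *s u"
            by (simp add: vec_eq_iff algebra_simps)
          show ?thesis unfolding diff vec.scale_scale using \<open>s \<noteq> t\<close> by simp
        qed
        finally have "(v + s *s u) - s *s u \<in> W"
          using that(1) \<open>vec.subspace W\<close> by (intro vec.subspace_diff vec.subspace_scale) auto
        then show False using v[OF W] by simp
      qed
      then show ?thesis using finite_if_at_most_one[of "\<lambda>t. v + t *s u \<in> W"] by blast
    qed
    then have "finite (insert 0 (\<Union>W\<in>\<W>. {t. v + t *s u \<in> W}))" using insert.hyps by auto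
    then obtain t where "t \<notin> insert 0 (\<Union>W\<in>\<W>. {t. v + t *s u \<in> W})"
      using ex_new_if_finite[OF infinite_UNIV_char_0[where 'a = complex]] by metis
    then have t: "t \<noteq> 0" "\<And>W. W \<in> \<W> \<Longrightarrow> v + t *s u \<notin> W" by auto
    have "v + t *s u \<notin> W0"
    proof
      assume "v + t *s u \<in> W0"
      then have "(1 / t) *s ((v + t *s u) - v) \<in> W0"
        using True insert.prems by (intro vec.subspace_scale vec.subspace_diff) auto
      then show False using t(1) u by (simp add: vec.scale_scale)
    qed
    with t(2) show ?thesis by blast
  qed
qed auto

text \<open>A vector \<open>r\<close> completes the rows of \<open>C\<close> to a spanning set, so a vector of the kernel is determined
  by its product with \<open>r\<close>.\<close>

lemma pinhole_camera_center:
  assumes "pinhole_camera C"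
  shows "\<exists>c. c \<noteq> 0 \<and> center C = vec.span {c}"
proof -
  have rows: "C *v v = 0 \<longleftrightarrow> (\<forall>i. (\<Sum>j\<in>UNIV. C $ i $ j * v $ j) = 0)" for v
    by (simp add: matrix_vector_mult_def vec_eq_iff)
  have "vec.dim (rows C) = 3" using assms by (simp add: pinhole_camera_def row_rank_def_gen)
  moreover have "vec.dim (UNIV :: (complex^4) set) = 4" by (simp add: card_cart_basis)
  ultimately have "vec.span (rows C) \<noteq> UNIV" using vec.dim_span[of "rows C"] by force
  then obtain r where r: "r \<notin> vec.span (rows C)" by blast
  have "vec.dim (insert r (rows C)) = 4"
    using r \<open>vec.dim (rows C) = 3\<close> by (simp add: vec.dim_insert)
  then have span: "vec.span (insert r (rows C)) = UNIV"
    using vec.dim_eq_full[of "insert r (rows C)"] 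
    by (simp add: vec.dimension_def card_cart_basis)
  have inj: "v = 0" if v: "C *v v = 0" "(\<Sum>j\<in>UNIV. r $ j * v $ j) = 0" for v
  proof -
    let ?O = "{x. (\<Sum>j\<in>UNIV. x $ j * v $ j) = 0}"
    have "vec.subspace ?O"
      by (auto simp: vec.subspace_def distrib_right sum.distrib mult.assoc simp flip: sum_distrib_left)
    moreover have "insert r (rows C) \<subseteq> ?O" using v rows by (auto simp: rows_def row_def)
    ultimately have "vec.span (insert r (rows C)) \<subseteq> ?O" by (intro vec.span_minimal)
    then have O: "x \<in> ?O" for x unfolding span by (rule subsetD) simp
    have "v $ i = 0" for i
    proof -
      have "(\<Sum>j\<in>UNIV. axis i 1 $ j * v $ j) = (\<Sum>j\<in>UNIV. if j = i then v $ j else 0)"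
        by (intro sum.cong) (auto simp: axis_def)
      also have "\<dots> = v $ i" by simp
      finally show ?thesis using O[of "axis i 1"] by (simp only: mem_Collect_eq)
    qed
    then show "v = 0" by (simp add: vec_eq_iff)
  qed
  obtain a where a: "\<exists>j\<in>UNIV. a j \<noteq> 0" "\<forall>i\<in>UNIV. (\<Sum>j\<in>UNIV. a j * C $ i $ j) = 0"
    using homogeneous_system_nontrivial_solution[of "UNIV :: 3 set" "UNIV :: 4 set" "\<lambda>j i. C $ i $ j"]
    by auto
  define c where "c = (\<chi> j. a j)"
  have "c \<noteq> 0" using a(1) by (auto simp: c_def vec_eq_iff)
  moreover have "C *v c = 0" unfolding rows using a(2) by (simp add: c_def mult.commute)
  ultimately have c: "c \<noteq> 0" "C *v c = 0" by auto
  let ?r = "\<lambda>v. \<Sum>j\<in>UNIV. r $ j * v $ j"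
  have rc: "?r c \<noteq> 0" using inj c by blast
  have "v \<in> vec.span {c}" if v: "C *v v = 0" for v
  proof -
    let ?w = "?r c *s v - ?r v *s c"
    have "C *v ?w = 0" using v c(2)
      by (simp add: matrix_vector_mult_diff_distrib vector_scalar_commute)
    moreover have "?r (p *s x - q *s y) = p * ?r x - q * ?r y" for p q x y
      by (simp add: right_diff_distrib sum_subtractf sum_distrib_left mult.left_commute)
    then have "?r ?w = 0" by (simp only: mult.commute[of "?r c"] diff_self)
    ultimately have "?r c *s v = ?r v *s c" using inj by force
    then have "v = (?r v / ?r c) *s c" using rc by (simp add: vec_eq_iff field_simps)
    then show ?thesis by (metis vec.span_base vec.span_scale insertI1)
  qed
  moreover have "C *v v = 0" if "v \<in> vec.span {c}" for v
    using that c(2) by (auto simp: vec.span_singleton vector_scalar_commute)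
  ultimately show ?thesis using c(1) by (intro exI[of _ c]) (auto simp: center_def)
qed


section \<open>Images of lines under cameras\<close>

text \<open>Representatives of the images of the line through \<open>x\<close> and \<open>y\<close>. For pinhole cameras, the
  \<open>i\<close>-th one vanishes exactly if that line passes through the center of the \<open>i\<close>-th
  camera or \<open>x\<close> and \<open>y\<close> do not span a line.\<close>

definition image_lines :: "('m \<Rightarrow> complex^4^3) \<Rightarrow> complex^4 \<Rightarrow> complex^4 \<Rightarrow> 'm \<Rightarrow> complex^3" where
  "image_lines C x y = (\<lambda>i. ccross (C i *v x) (C i *v y))"

lemma camera_combination:
  fixes A :: "complex^4^3"
  shows "A *v (a *s x + b *s y) = a *s (A *v x) + b *s (A *v y)"
  by (simp add: matrix_vector_right_distrib vector_scalar_commute)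

lemma on_line_abs:
  "u \<noteq> 0 \<Longrightarrow> l \<noteq> 0 \<Longrightarrow> on_line (abs_proj u) (abs_proj l) \<longleftrightarrow> (\<Sum>j\<in>UNIV. u $ j * l $ j) = 0"
  by (rule on_line.abs_eq) (simp_all add: proj_rel_refl)

lemma ccross_nonzero_imp: "ccross u v \<noteq> 0 \<Longrightarrow> u \<noteq> 0 \<and> v \<noteq> 0"
  by (auto simp: vec_eq_iff forall_3 ccross_component)

lemma ccross_orthogonal:
  "(\<Sum>j\<in>UNIV. u $ j * ccross u v $ j) = 0" "(\<Sum>j\<in>UNIV. v $ j * ccross u v $ j) = 0"
  by (simp_all add: sum_3 ccross_component algebra_simps)

text \<open>Another pair of spanning points changes the cross product by the determinant of the base change,
  which is a nonzero scalar.\<close>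

lemma camera_line_span:
  assumes "ccross (A *v x) (A *v y) \<noteq> 0"
  shows "camera_line A (vec.span {x, y}) = abs_proj (ccross (A *v x) (A *v y))"
  unfolding camera_line_def
proof (rule the_equality)
  let ?n = "ccross (A *v x) (A *v y)"
  have nz: "A *v x \<noteq> 0" "A *v y \<noteq> 0" using ccross_nonzero_imp[OF assms] by auto
  have "on_line (abs_proj (A *v x)) (abs_proj ?n)" "on_line (abs_proj (A *v y)) (abs_proj ?n)"
    using assms nz by (simp_all add: on_line_abs ccross_orthogonal)
  then show "\<exists>x' y'. vec.span {x, y} = vec.span {x', y'} \<and>
      on_line (abs_proj (A *v x')) (abs_proj ?n) \<and> on_line (abs_proj (A *v y')) (abs_proj ?n)" by blast
  fix l assume "\<exists>x' y'. vec.span {x, y} = vec.span {x', y'} \<and>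
      on_line (abs_proj (A *v x')) l \<and> on_line (abs_proj (A *v y')) l"
  then obtain x' y' where xy': "vec.span {x, y} = vec.span {x', y'}"
    and on: "on_line (abs_proj (A *v x')) l" "on_line (abs_proj (A *v y')) l" by blast
  have "x \<in> vec.span {x', y'}" "y \<in> vec.span {x', y'}"
    using vec.span_base[of x "{x, y}"] vec.span_base[of y "{x, y}"] xy' by auto
  then obtain a b c d where "x = a *s x' + b *s y'" "y = c *s x' + d *s y'"
    unfolding span_pair_iff by blast
  then obtain m where n: "?n = m *s ccross (A *v x') (A *v y')"
    by (simp only: camera_combination ccross_combination)
  then have n': "ccross (A *v x') (A *v y') \<noteq> 0" using assms by auto
  define r where "r = rep_proj l"
  have r: "r \<noteq> 0" "l = abs_proj r" by (simp_all add: r_def rep_proj_nonzero abs_rep_proj)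
  obtain k where k: "r = k *s ccross (A *v x') (A *v y')"
    using orthogonal_to_both_imp_multiple[of "A *v x'" r "A *v y'"] on n' ccross_nonzero_imp[OF n'] r
    by (auto simp: on_line_abs)
  have "m \<noteq> 0" using n assms by auto
  then have "r = (k / m) *s ?n" by (simp add: k n)
  then show "l = abs_proj ?n" using abs_proj_eq_iff[OF assms r(1)] r(2) by metis
qed

lemma ccross_camera_eq_0_imp:
  assumes "center A = vec.span {c}" "ccross (A *v x) (A *v y) = 0"
  obtains a b k where "a \<noteq> 0 \<or> b \<noteq> 0" "a *s x + b *s y = k *s c"
proof -
  obtain a b where ab: "a \<noteq> 0 \<or> b \<noteq> 0" "a *s (A *v x) + b *s (A *v y) = 0"
    using ccross_eq_0_imp[OF assms(2)] by blast
  then have "a *s x + b *s y \<in> center A" by (simp add: center_def camera_combination)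
  then show ?thesis using that ab(1) unfolding assms(1) vec.span_singleton by blast
qed

lemma joint_camera_image:
  fixes C :: "'m::finite \<Rightarrow> complex^4^3"
  assumes "\<And>i. pinhole_camera (C i)"
  shows "joint_camera_map C ` joint_camera_domain C =
    {point (image_lines C x y) |x y. \<forall>i. image_lines C x y i \<noteq> 0}" (is "?lhs = ?rhs")
proof -
  have map: "joint_camera_map C (vec.span {x, y}) = point (image_lines C x y)"
    if "\<forall>i. image_lines C x y i \<noteq> 0" for x y
    using that by (simp add: joint_camera_map_def point_def image_lines_def camera_line_span)
  have "\<forall>i. \<exists>c. c \<noteq> 0 \<and> center (C i) = vec.span {c}" using assms pinhole_camera_center by blast
  then obtain c where c: "\<And>i. c i \<noteq> 0" "\<And>i. center (C i) = vec.span {c i}" by metis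
  show ?thesis
  proof (intro equalityI subsetI)
    fix X assume "X \<in> ?lhs"
    then obtain L where L: "L \<in> joint_camera_domain C" "X = joint_camera_map C L" by blast
    then have sub: "vec.subspace L" "vec.dim L = 2" by (auto simp: joint_camera_domain_def lines_P3_def)
    obtain B where B: "B \<subseteq> L" "vec.independent B" "L \<subseteq> vec.span B" "card B = 2"
      using vec.basis_exists[of L] sub(2) by metis
    then obtain x y where xy: "B = {x, y}" "x \<noteq> y" by (auto simp: card_2_iff)
    have span: "L = vec.span {x, y}"
      using B sub(1) vec.span_minimal[of B L] by (auto simp: xy)
    have "image_lines C x y i \<noteq> 0" for i
    proof
      assume "image_lines C x y i = 0"
      then obtain a b k where ab: "a \<noteq> 0 \<or> b \<noteq> 0" "a *s x + b *s y = k *s c i"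
        using ccross_camera_eq_0_imp[OF c(2)] by (metis image_lines_def)
      have "k \<noteq> 0"
      proof
        assume "k = 0"
        then have 0: "a *s x + b *s y = 0" using ab by simp
        have "x \<in> vec.span {y}" if "a \<noteq> 0"
        proof -
          have "x = (- b / a) *s y" using 0 that
            by (simp add: vec_eq_iff field_simps eq_neg_iff_add_eq_0)
          then show ?thesis by (metis vec.span_base vec.span_scale insertI1)
        qed
        moreover have "y \<in> vec.span {x}" if "b \<noteq> 0"
        proof -
          have "y = (- a / b) *s x" using 0 that
            by (simp add: vec_eq_iff field_simps eq_neg_iff_add_eq_0)
          then show ?thesis by (metis vec.span_base vec.span_scale insertI1)
        qed
        moreover have "x \<notin> vec.span {y}" "y \<notin> vec.span {x}"
          using B(2) xy by (auto simp: vec.dependent_def insert_Diff_if)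
        ultimately show False using ab(1) by blast
      qed
      then have "c i = (1 / k) *s (a *s x + b *s y)" using ab(2) by (simp add: vec.scale_scale)
      then have "c i \<in> L" unfolding span
        by (metis vec.span_scale span_pair_iff)
      then have "center (C i) \<subseteq> L" unfolding c(2) using sub(1) by (intro vec.span_minimal) auto
      then show False using L(1) by (auto simp: joint_camera_domain_def)
    qed
    then show "X \<in> ?rhs" using map L(2) span by blast
  next
    fix X assume "X \<in> ?rhs"
    then obtain x y where xy: "X = point (image_lines C x y)" "\<forall>i. image_lines C x y i \<noteq> 0" by blast
    have nz: "a = 0 \<and> b = 0" if "a *s x + b *s y \<in> center (C i)" for a b i
    proof (rule ccontr)
      assume "\<not> ?thesis"
      moreover have "a *s (C i *v x) + b *s (C i *v y) = 0"
        using that by (simp add: center_def camera_combination)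
      ultimately have "ccross (C i *v x) (C i *v y) = 0" by (intro ccross_eq_0) auto
      then show False using xy(2) by (simp add: image_lines_def)
    qed
    have indep: "a = 0 \<and> b = 0" if "a *s x + b *s y = 0" for a b
      using nz[of a b undefined] that by (simp add: center_def)
    have "y \<noteq> 0" using indep[of 0 1] by auto
    moreover have "x \<notin> vec.span {y}"
    proof
      assume "x \<in> vec.span {y}"
      then obtain k where "x = k *s y" by (auto simp: vec.span_singleton)
      then show False using indep[of 1 "- k"] by simp
    qed
    ultimately have "vec.independent {x, y}"
      by (simp add: vec.independent_insert)
    moreover have "x \<noteq> y" using \<open>x \<notin> _\<close> vec.span_base[of y "{y}"] by auto
    ultimately have "vec.dim (vec.span {x, y}) = 2"
      by (simp add: vec.dim_eq_card_independent)
    moreover have "\<not> center (C i) \<subseteq> vec.span {x, y}" for i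
    proof
      assume "center (C i) \<subseteq> vec.span {x, y}"
      moreover have "c i \<in> center (C i)" by (simp add: c vec.span_base)
      ultimately obtain a b where "c i = a *s x + b *s y" "c i \<in> center (C i)"
        using span_pair_iff by blast
      then show False using nz[of a b i] c(1)[of i] by auto
    qed
    ultimately have "vec.span {x, y} \<in> joint_camera_domain C"
      by (simp add: joint_camera_domain_def lines_P3_def)
    then show "X \<in> ?lhs" using map[OF xy(2)] xy(1) by (metis imageI)
  qed
qed


section \<open>A chart of the Grassmannian adapted to two cameras\<close>

text \<open>A generic choice of \<open>b0\<close> and then of \<open>b1\<close> works, since each condition excludes a proper
  subspace. When \<open>c\<close> lists all camera centers and \<open>p\<close>, \<open>q\<close> are two of them, the last property
  says that the line through \<open>b0\<close> and \<open>b1\<close> avoids every center, so that it is in the domain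
  of the joint camera map.\<close>

lemma generic_frame:
  fixes c :: "'m::finite \<Rightarrow> complex^4"
  assumes "p \<noteq> 0" "q \<notin> vec.span {p}"
  obtains b0 b1 where
    "\<And>v. \<exists>\<alpha> \<beta> \<gamma> \<delta>. v = \<alpha> *s b0 + \<beta> *s b1 + \<gamma> *s p + \<delta> *s q"
    "\<And>\<alpha> \<beta> \<gamma> \<delta>. \<alpha> *s b0 + \<beta> *s b1 + \<gamma> *s p + \<delta> *s q = 0 \<Longrightarrow> \<alpha> = 0 \<and> \<beta> = 0 \<and> \<gamma> = 0 \<and> \<delta> = 0"
    "\<And>i \<alpha> \<beta> k. \<alpha> *s b0 + \<beta> *s b1 = k *s c i \<Longrightarrow> \<alpha> = 0 \<and> \<beta> = 0"
proof -
  have proper: "vec.subspace (vec.span S) \<and> vec.span S \<noteq> UNIV"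
    if "S = {x, y, z}" for S and x y z :: "complex^4"
    using small_span_proper[of S] card_insert_le_m1[of 3 "{y, z}" x] card_insert_le_m1[of 2 "{z}" y] that
    by (simp add: vec.subspace_span)
  have scale_mem: "x \<in> vec.span S" if "k \<noteq> 0" "k *s x \<in> vec.span S" for k S and x :: "complex^4"
    using vec.span_scale[OF that(2), of "1 / k"] that(1) by simp
  have "\<exists>v. \<forall>W\<in>range (\<lambda>i. vec.span {q, p, c i}). v \<notin> W"
    by (rule ex_outside_proper_subspaces) (use proper[OF refl] in auto)
  then obtain b0 where b0: "\<And>i. b0 \<notin> vec.span {q, p, c i}" by auto
  have b0': "b0 \<notin> vec.span {q, p}" "b0 \<notin> vec.span {c i}" for i
    using b0[of i] vec.span_mono[of "{q, p}" "{q, p, c i}"] vec.span_mono[of "{c i}" "{q, p, c i}"] by auto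
  have "\<exists>v. \<forall>W\<in>insert (vec.span {b0, q, p}) (range (\<lambda>i. vec.span {b0, c i})). v \<notin> W"
    by (rule ex_outside_proper_subspaces) (use proper[OF refl] proper[OF refl, of b0 b0] in auto)
  then obtain b1 where "\<forall>W\<in>insert (vec.span {b0, q, p}) (range (\<lambda>i. vec.span {b0, c i})). b1 \<notin> W" ..
  then have b1: "b1 \<notin> vec.span {b0, q, p}" "\<And>i. b1 \<notin> vec.span {b0, c i}" by simp_all
  have ne: "p \<noteq> q" "b0 \<notin> {q, p}" "b1 \<notin> {b0, q, p}"
    using assms(2) b0' b1(1) vec.span_base[of _ "{b0, q, p}"] vec.span_base[of _ "{q, p}"]
      vec.span_base[of p "{p}"] by auto
  have ind: "vec.independent {b1, b0, q, p}"
    using assms b0'(1) b1(1) ne by (auto simp: vec.independent_insert)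
  have "card {b1, b0, q, p} = 4" using ne by auto
  then have "UNIV \<subseteq> vec.span {b1, b0, q, p}"
    using ind by (intro vec.card_ge_dim_independent) (auto simp: card_cart_basis)
  then have mem: "v \<in> vec.span {b1, b0, q, p}" for v by blast
  show ?thesis
  proof
    show "\<exists>\<alpha> \<beta> \<gamma> \<delta>. v = \<alpha> *s b0 + \<beta> *s b1 + \<gamma> *s p + \<delta> *s q" for v
    proof -
      obtain \<beta> w where v: "v = \<beta> *s b1 + w" "w \<in> vec.span {b0, q, p}"
        using mem[of v] unfolding span_insert_iff[of v] by blast
      obtain \<alpha> w' where w: "w = \<alpha> *s b0 + w'" "w' \<in> vec.span {q, p}"
        using v(2) unfolding span_insert_iff[of w] by blast
      obtain \<delta> \<gamma> where "w' = \<delta> *s q + \<gamma> *s p" using w(2) unfolding span_pair_iff by blast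
      then have "v = \<alpha> *s b0 + \<beta> *s b1 + \<gamma> *s p + \<delta> *s q"
        by (simp add: v(1) w(1) algebra_simps)
      then show ?thesis by blast
    qed
  next
    fix \<alpha> \<beta> \<gamma> \<delta> assume 0: "\<alpha> *s b0 + \<beta> *s b1 + \<gamma> *s p + \<delta> *s q = 0"
    have "\<beta> *s b1 = (- \<alpha>) *s b0 + ((- \<delta>) *s q + (- \<gamma>) *s p)"
      using 0 by (simp add: eq_neg_iff_add_eq_0 algebra_simps)
    then have "\<beta> *s b1 \<in> vec.span {b0, q, p}"
      unfolding span_insert_iff[of _ b0 "{q, p}"] using span_pair_iff by blast
    then have \<beta>: "\<beta> = 0" using scale_mem b1(1) by blast
    then have "\<alpha> *s b0 = (- \<delta>) *s q + (- \<gamma>) *s p"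
      using 0 by (simp add: eq_neg_iff_add_eq_0 algebra_simps)
    then have "\<alpha> *s b0 \<in> vec.span {q, p}" unfolding span_pair_iff by blast
    then have \<alpha>: "\<alpha> = 0" using scale_mem b0'(1) by blast
    have "\<delta> *s q = (- \<gamma>) *s p" using 0 \<alpha> \<beta> by (simp add: eq_neg_iff_add_eq_0 algebra_simps)
    then have "\<delta> *s q \<in> vec.span {p}" unfolding vec.span_singleton by blast
    then have "\<delta> = 0" using scale_mem assms(2) by blast
    then show "\<alpha> = 0 \<and> \<beta> = 0 \<and> \<gamma> = 0 \<and> \<delta> = 0" using 0 \<alpha> \<beta> assms(1) by simp
  next
    fix i \<alpha> \<beta> k assume eq: "\<alpha> *s b0 + \<beta> *s b1 = k *s c i"
    have "\<beta> *s b1 = (- \<alpha>) *s b0 + k *s c i" using eq by (simp add: algebra_simps)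
    then have "\<beta> *s b1 \<in> vec.span {b0, c i}" unfolding span_pair_iff by blast
    then have \<beta>: "\<beta> = 0" using scale_mem b1(2) by blast
    then have "\<alpha> *s b0 \<in> vec.span {c i}" using eq by (auto simp: vec.span_singleton)
    then show "\<alpha> = 0 \<and> \<beta> = 0" using \<beta> scale_mem b0'(2) by blast
  qed
qed

lemma linear_form_polynomial:
  "\<exists>p :: ('m::finite \<times> 'n::finite) cpoly. multihomogeneous p \<and>
     (\<forall>x. eval_poly p (hcoord x) = (\<Sum>j\<in>UNIV. w $ j * x i $ j))"
proof -
  let ?p = "\<Sum>j\<in>UNIV. Poly_Mapping.single 0 (w $ j) * poly_var (i, j) :: ('m \<times> 'n) cpoly"
  have "has_multidegree (\<lambda>k. 0 + of_bool (k = i)) ?p"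
    by (intro has_multidegree_sum has_multidegree_mult has_multidegree_const has_multidegree_var) auto
  then have "multihomogeneous ?p" by (auto simp: multihomogeneous_iff)
  moreover have "eval_poly ?p (hcoord x) = (\<Sum>j\<in>UNIV. w $ j * x i $ j)" for x
    by (simp add: eval_poly_sum eval_poly_mult eval_poly_const hcoord_def)
  ultimately show ?thesis by blast
qed

lemma (in function_algebra) ccross_component_in:
  assumes "\<And>j. (\<lambda>x. u x $ j) \<in> R" "\<And>j. (\<lambda>x. v x $ j) \<in> R"
  shows "(\<lambda>x. ccross (u x) (v x) $ k) \<in> R"
  using exhaust_3[of k] by (auto simp: ccross_component intro!: diff mult assms)

lemma point_scale:
  assumes "\<And>i. v i \<noteq> 0" "k \<noteq> 0"
  shows "point (\<lambda>i. k *s v i) = point v"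
proof
  fix i
  have "abs_proj (v i) = abs_proj (k *s v i)"
    using assms by (subst abs_proj_eq_iff) auto
  then show "point (\<lambda>i. k *s v i) i = point v i" by (simp add: point_def)
qed

theorem theorem2p1:
  fixes C :: "'m::finite \<Rightarrow> complex^4^3"
  assumes "CARD('m) \<ge> 2"
    and "\<And>i. pinhole_camera (C i)"
    and "inj (\<lambda>i. center (C i))"
  shows "irreducible_variety (line_multiview_variety C) \<and>
         variety_dim (line_multiview_variety C) = 4"
proof -
  note cam = assms(2) and inj = assms(3)
  have "\<forall>i. \<exists>c. c \<noteq> 0 \<and> center (C i) = vec.span {c}" using cam pinhole_camera_center by blast
  then obtain c where c: "\<And>i. c i \<noteq> 0" "\<And>i. center (C i) = vec.span {c i}" by metis
  obtain i1 i2 :: 'm where ne: "i1 \<noteq> i2"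
    using assms(1) card_le_Suc0_iff_eq[of "UNIV :: 'm set"] by fastforce
  define p q where "p = c i1" and "q = c i2"
  have "q \<notin> vec.span {p}"
  proof
    assume "q \<in> vec.span {p}"
    then obtain k where k: "q = k *s p" by (auto simp: vec.span_singleton)
    then have "k \<noteq> 0" using c(1)[of i2] by (auto simp: q_def)
    then have "p = (1 / k) *s q" using k by simp
    then have "p \<in> vec.span {q}" by (metis vec.span_base vec.span_scale insertI1)
    then have "vec.span {p} = vec.span {q}"
      using \<open>q \<in> vec.span {p}\<close> vec.span_minimal[OF _ vec.subspace_span] by (meson empty_subsetI insert_subset subset_antisym)
    then show False using ne inj c(2) by (auto simp: p_def q_def dest: injD)
  qed
  then obtain b0 b1 where
    spanning: "\<And>v. \<exists>\<alpha> \<beta> \<gamma> \<delta>. v = \<alpha> *s b0 + \<beta> *s b1 + \<gamma> *s p + \<delta> *s q"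
    and indep: "\<And>\<alpha> \<beta> \<gamma> \<delta>. \<alpha> *s b0 + \<beta> *s b1 + \<gamma> *s p + \<delta> *s q = 0 \<Longrightarrow>
        \<alpha> = 0 \<and> \<beta> = 0 \<and> \<gamma> = 0 \<and> \<delta> = 0"
    and avoid: "\<And>i \<alpha> \<beta> k. \<alpha> *s b0 + \<beta> *s b1 = k *s c i \<Longrightarrow> \<alpha> = 0 \<and> \<beta> = 0"
    using generic_frame[of p q c] c(1)[of i1] unfolding p_def by metis

  \<comment> \<open>The lines that miss the line through \<open>p\<close> and \<open>q\<close> are spanned by a unique pair \<open>x s\<close>, \<open>y s\<close>. Since
    camera \<open>i1\<close> kills \<open>p\<close>, its image line depends on \<open>s 1\<close> and \<open>s 2\<close> only; that of camera \<open>i2\<close> depends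
    on \<open>s 3\<close> and \<open>s 4\<close> only.\<close>
  define x where "x = (\<lambda>s :: 4 \<Rightarrow> complex. b0 + s 3 *s p + s 1 *s q)"
  define y where "y = (\<lambda>s :: 4 \<Rightarrow> complex. b1 + s 4 *s p + s 2 *s q)"
  define \<phi> where "\<phi> = (\<lambda>s. image_lines C (x s) (y s))"
  define A where "A = {point (image_lines C u v) |u v. \<forall>i. image_lines C u v i \<noteq> 0}"
  define B where "B = {point (\<phi> s) |s. \<forall>i. \<phi> s i \<noteq> 0}"
  have cam_x: "K *v x s = K *v b0 + s 3 *s (K *v p) + s 1 *s (K *v q)" for K :: "complex^4^3" and s
    by (simp add: x_def matrix_vector_right_distrib vector_scalar_commute)
  have cam_y: "K *v y s = K *v b1 + s 4 *s (K *v p) + s 2 *s (K *v q)" for K :: "complex^4^3" and s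
    by (simp add: y_def matrix_vector_right_distrib vector_scalar_commute)

  have \<phi>_poly: "(\<lambda>s. \<phi> s i $ j) \<in> range eval_poly" for i j
    unfolding \<phi>_def image_lines_def
  proof (rule multivariate.ccross_component_in)
    show "(\<lambda>s. (C i *v x s) $ j) \<in> range eval_poly" for j
      unfolding cam_x vector_add_component vector_smult_component
      by (intro multivariate.add multivariate.mult multivariate.const multivariate_var)
    show "(\<lambda>s. (C i *v y s) $ j) \<in> range eval_poly" for j
      unfolding cam_y vector_add_component vector_smult_component
      by (intro multivariate.add multivariate.mult multivariate.const multivariate_var)
  qed
  have \<phi>_base: "\<phi> (\<lambda>_. 0) i \<noteq> 0" for i
  proof
    assume "\<phi> (\<lambda>_. 0) i = 0"
    then have "ccross (C i *v b0) (C i *v b1) = 0" by (simp add: \<phi>_def image_lines_def x_def y_def)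
    then show False using ccross_camera_eq_0_imp[OF c(2)] avoid by metis
  qed

  \<comment> \<open>The coordinate \<open>s l\<close> vanishes if and only if the image line passes through the image of \<open>b0\<close>,
    and \<open>s l'\<close> if and only if it passes through the image of \<open>b1\<close>. Both are linear conditions on the
    image line.\<close>
  have sep: "\<exists>P. multihomogeneous P \<and> (\<forall>s. eval_poly P (hcoord (\<phi> s)) = 0 \<longleftrightarrow> s l = 0) \<and>
      (\<exists>Q. multihomogeneous Q \<and> (\<forall>s. eval_poly Q (hcoord (\<phi> s)) = 0 \<longleftrightarrow> s l' = 0))"
    if q': "\<And>\<alpha> \<beta> \<gamma> k. \<alpha> *s b0 + \<beta> *s b1 + \<gamma> *s q' = k *s c i \<Longrightarrow> \<alpha> = 0 \<and> \<beta> = 0 \<and> \<gamma> = 0"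
      and \<phi>i: "\<And>s. \<phi> s i = ccross (C i *v b0 + s l *s (C i *v q')) (C i *v b1 + s l' *s (C i *v q'))"
    for i q' l l'
  proof -
    let ?u = "C i *v b0" and ?v = "C i *v b1" and ?w = "C i *v q'"
    have no_rel: "\<alpha> = 0 \<and> \<beta> = 0 \<and> \<gamma> = 0" if "\<alpha> *s ?u + \<beta> *s ?v + \<gamma> *s ?w = 0" for \<alpha> \<beta> \<gamma>
    proof -
      have "\<alpha> *s b0 + \<beta> *s b1 + \<gamma> *s q' \<in> center (C i)"
        using that by (simp add: center_def matrix_vector_right_distrib vector_scalar_commute)
      then show ?thesis using q' unfolding c(2) vec.span_singleton by blast
    qed
    have "(\<Sum>j\<in>UNIV. ?u $ j * \<phi> s i $ j) = s l * (\<Sum>j\<in>UNIV. ?u $ j * ccross ?w ?v $ j)" for s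
      by (simp add: \<phi>i sum_3 ccross_component algebra_simps)
    moreover have "(\<Sum>j\<in>UNIV. ?u $ j * ccross ?w ?v $ j) \<noteq> 0"
    proof
      assume "(\<Sum>j\<in>UNIV. ?u $ j * ccross ?w ?v $ j) = 0"
      then obtain \<alpha> \<gamma> \<beta> where "\<alpha> \<noteq> 0 \<or> \<gamma> \<noteq> 0 \<or> \<beta> \<noteq> 0" "\<alpha> *s ?u + \<gamma> *s ?w + \<beta> *s ?v = 0"
        using triple_product_eq_0_imp by blast
      then show False using no_rel[of \<alpha> \<beta> \<gamma>] by (simp add: add_ac)
    qed
    moreover have "(\<Sum>j\<in>UNIV. ?v $ j * \<phi> s i $ j) = s l' * (\<Sum>j\<in>UNIV. ?v $ j * ccross ?u ?w $ j)" for s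
      by (simp add: \<phi>i sum_3 ccross_component algebra_simps)
    moreover have "(\<Sum>j\<in>UNIV. ?v $ j * ccross ?u ?w $ j) \<noteq> 0"
    proof
      assume "(\<Sum>j\<in>UNIV. ?v $ j * ccross ?u ?w $ j) = 0"
      then obtain \<beta> \<alpha> \<gamma> where "\<beta> \<noteq> 0 \<or> \<alpha> \<noteq> 0 \<or> \<gamma> \<noteq> 0" "\<beta> *s ?v + \<alpha> *s ?u + \<gamma> *s ?w = 0"
        using triple_product_eq_0_imp by blast
      then show False using no_rel[of \<alpha> \<beta> \<gamma>] by (simp add: add_ac)
    qed
    moreover obtain P Q :: "('m \<times> 3) cpoly" where "multihomogeneous P" "multihomogeneous Q"
      "\<And>z. eval_poly P (hcoord z) = (\<Sum>j\<in>UNIV. ?u $ j * z i $ j)"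
      "\<And>z. eval_poly Q (hcoord z) = (\<Sum>j\<in>UNIV. ?v $ j * z i $ j)"
      using linear_form_polynomial[where 'm = 'm and 'n = 3] by metis
    ultimately show ?thesis by (intro exI[of _ P] conjI exI[of _ Q]) auto
  qed
  have Cp: "C i1 *v p = 0" and Cq: "C i2 *v q = 0"
    using c(2)[of i1] c(2)[of i2] vec.span_base[of p "{p}"] vec.span_base[of q "{q}"]
    by (auto simp: p_def q_def center_def)
  have sep1: "\<exists>P. multihomogeneous P \<and> (\<forall>s. eval_poly P (hcoord (\<phi> s)) = 0 \<longleftrightarrow> s 1 = 0) \<and>
      (\<exists>Q. multihomogeneous Q \<and> (\<forall>s. eval_poly Q (hcoord (\<phi> s)) = 0 \<longleftrightarrow> s 2 = 0))"
  proof (rule sep[of q i1])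
    fix \<alpha> \<beta> \<gamma> k assume "\<alpha> *s b0 + \<beta> *s b1 + \<gamma> *s q = k *s c i1"
    then have "\<alpha> *s b0 + \<beta> *s b1 + (- k) *s p + \<gamma> *s q = 0" by (simp add: p_def algebra_simps)
    then show "\<alpha> = 0 \<and> \<beta> = 0 \<and> \<gamma> = 0" using indep by blast
  qed (simp add: \<phi>_def image_lines_def cam_x cam_y Cp)
  have sep2: "\<exists>P. multihomogeneous P \<and> (\<forall>s. eval_poly P (hcoord (\<phi> s)) = 0 \<longleftrightarrow> s 3 = 0) \<and>
      (\<exists>Q. multihomogeneous Q \<and> (\<forall>s. eval_poly Q (hcoord (\<phi> s)) = 0 \<longleftrightarrow> s 4 = 0))"
  proof (rule sep[of p i2])
    fix \<alpha> \<beta> \<gamma> k assume "\<alpha> *s b0 + \<beta> *s b1 + \<gamma> *s p = k *s c i2"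
    then have "\<alpha> *s b0 + \<beta> *s b1 + \<gamma> *s p + (- k) *s q = 0" by (simp add: q_def algebra_simps)
    then show "\<alpha> = 0 \<and> \<beta> = 0 \<and> \<gamma> = 0" using indep by blast
  qed (simp add: \<phi>_def image_lines_def cam_x cam_y Cq)
  have separators: "\<exists>P. multihomogeneous P \<and> (\<forall>s. eval_poly P (hcoord (\<phi> s)) = 0 \<longleftrightarrow> s l = 0)" for l :: 4
    using exhaust_4[of l] sep1 sep2 by metis

  \<comment> \<open>Cramer's rule for the base change from \<open>u\<close>, \<open>v\<close> to the spanning pair of the chart.\<close>
  have in_B: "point (image_lines C u v) \<in> B"
    if u: "u = \<alpha> *s b0 + \<beta> *s b1 + \<gamma> *s p + \<delta> *s q"
      and v: "v = \<alpha>' *s b0 + \<beta>' *s b1 + \<gamma>' *s p + \<delta>' *s q"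
      and m: "\<alpha> * \<beta>' - \<beta> * \<alpha>' \<noteq> 0" and nz: "\<forall>i. image_lines C u v i \<noteq> 0"
    for u v \<alpha> \<beta> \<gamma> \<delta> \<alpha>' \<beta>' \<gamma>' \<delta>'
  proof -
    define m where "m = \<alpha> * \<beta>' - \<beta> * \<alpha>'"
    define s where "s = (\<lambda>l :: 4. if l = 1 then (\<beta>' * \<delta> - \<beta> * \<delta>') / m
      else if l = 2 then (\<alpha> * \<delta>' - \<alpha>' * \<delta>) / m
      else if l = 3 then (\<beta>' * \<gamma> - \<beta> * \<gamma>') / m else (\<alpha> * \<gamma>' - \<alpha>' * \<gamma>) / m)"
    have s: "s 1 = (\<beta>' * \<delta> - \<beta> * \<delta>') / m" "s 2 = (\<alpha> * \<delta>' - \<alpha>' * \<delta>) / m"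
      "s 3 = (\<beta>' * \<gamma> - \<beta> * \<gamma>') / m" "s 4 = (\<alpha> * \<gamma>' - \<alpha>' * \<gamma>) / m"
      by (simp_all add: s_def)
    have m0: "m \<noteq> 0" using m by (simp add: m_def)
    have coord: "\<alpha> * s 3 + \<beta> * s 4 = \<gamma>" "\<alpha> * s 1 + \<beta> * s 2 = \<delta>"
      "\<alpha>' * s 3 + \<beta>' * s 4 = \<gamma>'" "\<alpha>' * s 1 + \<beta>' * s 2 = \<delta>'"
      unfolding s using m0 by (simp_all add: field_simps) (simp_all add: m_def algebra_simps)
    have "\<alpha> *s x s + \<beta> *s y s = \<alpha> *s b0 + \<beta> *s b1 + (\<alpha> * s 3 + \<beta> * s 4) *s p + (\<alpha> * s 1 + \<beta> * s 2) *s q"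
      "\<alpha>' *s x s + \<beta>' *s y s = \<alpha>' *s b0 + \<beta>' *s b1 + (\<alpha>' * s 3 + \<beta>' * s 4) *s p + (\<alpha>' * s 1 + \<beta>' * s 2) *s q"
      by (simp_all add: x_def y_def vec_eq_iff algebra_simps)
    then have "u = \<alpha> *s x s + \<beta> *s y s" "v = \<alpha>' *s x s + \<beta>' *s y s"
      unfolding coord u v by simp_all
    then have eq: "image_lines C u v = (\<lambda>i. m *s \<phi> s i)"
      by (simp add: image_lines_def \<phi>_def camera_combination ccross_combination m_def)
    have "\<phi> s i \<noteq> 0" for i using nz unfolding eq by auto
    then show ?thesis using point_scale[of "\<phi> s" m] m0 unfolding eq B_def by auto
  qed
  \<comment> \<open>The chart is dense: joining the pair \<open>u\<close>, \<open>v\<close> linearly to \<open>b0\<close>, \<open>b1\<close> gives lines that generically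
    lie in it. Here \<open>f t\<close> is the minor of the coordinates at \<open>b0\<close> and \<open>b1\<close>, with \<open>f 1 = 1\<close>.\<close>
  have "A \<subseteq> zariski closure_of B"
  proof
    fix X assume "X \<in> A"
    then obtain u v where X: "X = point (image_lines C u v)" and nz: "\<And>i. image_lines C u v i \<noteq> 0"
      unfolding A_def by blast
    obtain \<alpha> \<beta> \<gamma> \<delta> where u: "u = \<alpha> *s b0 + \<beta> *s b1 + \<gamma> *s p + \<delta> *s q" using spanning by blast
    obtain \<alpha>' \<beta>' \<gamma>' \<delta>' where v: "v = \<alpha>' *s b0 + \<beta>' *s b1 + \<gamma>' *s p + \<delta>' *s q" using spanning by blast
    define U where "U = (\<lambda>t. (1 - t) *s u + t *s b0)"
    define V where "V = (\<lambda>t. (1 - t) *s v + t *s b1)"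
    define f where "f = (\<lambda>t. ((1 - t) * \<alpha> + t) * ((1 - t) * \<beta>' + t) - ((1 - t) * \<beta>) * ((1 - t) * \<alpha>'))"
    have "point (image_lines C (U 0) (V 0)) \<in> zariski closure_of B"
    proof (rule limit_of_curve_in_closed[of _ "\<lambda>t. image_lines C (U t) (V t)" f 1 0])
      show "(\<lambda>t. image_lines C (U t) (V t) i $ j) \<in> range poly" for i j
        unfolding image_lines_def
      proof (rule univariate.ccross_component_in)
        show "(\<lambda>t. (C i *v U t) $ j) \<in> range poly" for j
          unfolding U_def camera_combination vector_add_component vector_smult_component
          by (intro univariate.add univariate.mult univariate.diff univariate.const univariate_id)
        show "(\<lambda>t. (C i *v V t) $ j) \<in> range poly" for j
          unfolding V_def camera_combination vector_add_component vector_smult_component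
          by (intro univariate.add univariate.mult univariate.diff univariate.const univariate_id)
      qed
      show "f \<in> range poly" unfolding f_def
        by (intro univariate.add univariate.mult univariate.diff univariate.const univariate_id)
      fix t assume t: "f t \<noteq> 0" "\<forall>i. image_lines C (U t) (V t) i \<noteq> 0"
      have "point (image_lines C (U t) (V t)) \<in> B"
      proof (rule in_B[OF _ _ _ t(2)])
        show "U t = ((1 - t) * \<alpha> + t) *s b0 + ((1 - t) * \<beta>) *s b1 + ((1 - t) * \<gamma>) *s p + ((1 - t) * \<delta>) *s q"
          by (simp add: U_def u vec_eq_iff algebra_simps)
        show "V t = ((1 - t) * \<alpha>') *s b0 + ((1 - t) * \<beta>' + t) *s b1 + ((1 - t) * \<gamma>') *s p + ((1 - t) * \<delta>') *s q"
          by (simp add: V_def v vec_eq_iff algebra_simps)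
      qed (use t(1) in \<open>simp add: f_def\<close>)
      then show "point (image_lines C (U t) (V t)) \<in> zariski closure_of B"
        using closure_of_subset[of B zariski] by auto
    qed (use nz in \<open>simp_all add: f_def U_def V_def\<close>)
    then show "X \<in> zariski closure_of B" by (simp add: X U_def V_def)
  qed
  moreover have "B \<subseteq> A" unfolding A_def B_def \<phi>_def by blast
  ultimately have "zariski closure_of A = zariski closure_of B"
    by (intro equalityI closure_of_minimal closure_of_mono) auto
  then have V: "line_multiview_variety C = zariski closure_of {point (\<phi> s) |s. \<forall>i. \<phi> s i \<noteq> 0}"
    unfolding line_multiview_variety_def joint_camera_image[OF cam] by (simp add: A_def B_def)
  show ?thesis
    unfolding V
    using variety_dim_parametrized_ge[of \<phi>, OF \<phi>_poly \<phi>_base separators] variety_dim_parametrized_le[of \<phi>, OF \<phi>_poly]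
    by (simp add: numeral_eq_enat order_antisym)
qed

end
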